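(* Let $(X,L)$ be a polarized toric variety with associated general system $(P,d\mu,d\sigma)$, let $\lambda\le0$ and $\xi\in\mathfrak{t}$. Then $(X,L)$ is toric $\mu^\lambda_\xi$K-semistable if and only if the linear function $\langle\cdot,\xi\rangle:P\to\mathbb{R}$ maximizes $\check{\mu}^\lambda_{\mathrm{NA}}$ on $\mathcal{E}^1(P)$, i.e. $\check{\mu}^\lambda_{\mathrm{NA}}(q)\le\check{\mu}^\lambda_{\mathrm{NA}}(\langle\cdot,\xi\rangle)$ for all $q\in\mathcal{E}^1(P)$.
   Context: Let $T\cong\mathbb{G}_m^n$ be an algebraic torus with character lattice $M$, $\mathfrak{t}^\vee:=M\otimes_{\mathbb{Z}}\mathbb{R}$ and $\mathfrak{t}$ its dual. For a polarized toric variety $(X,L)$ of dimension $n$, the associated general system $(P,d\mu,d\sigma)$ is: $P:=\mathrm{Conv}\{m\in M: H^0(X,L)_m\neq0\}\subset\mathfrak{t}^\vee$ (the moment lattice polytope, with non-empty interior); $d\mu$ the restriction to $P$ of the Lebesgue measure on $\mathfrak{t}^\vee$ normalized so that a fundamental domain of $M$ has volume $1$; $d\sigma$ the measure on $\partial P$ whose restriction to each facet $Q$ is the Lebesgue measure on the affine span $W$ of $Q$ normalized so that a fundamental domain of the lattice $W\cap M$ (translated) has volume $1$. $\mathcal{E}^1(P)$ denotes the set of lower semicontinuous convex functions $q:P\to(-\infty,\infty]$ with $\int_Pe^q\,d\mu<\infty$. For $q\in\mathcal{E}^1(P)$ put $\boldsymbol{\sigma}(q):=\frac{\int_P(n+q)e^q\,d\mu}{\int_Pe^q\,d\mu}-\log\int_Pe^q\,d\mu$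 and $\check{\mu}_{\mathrm{NA}}(q):=-2\pi\frac{\int_{\partial P}e^q\,d\sigma}{\int_Pe^q\,d\mu}\in[-\infty,0)$, and $\check{\mu}^\lambda_{\mathrm{NA}}(q):=\check{\mu}_{\mathrm{NA}}(q)+\lambda\boldsymbol{\sigma}(q)$ if $\boldsymbol{\sigma}(q)<\infty$, $\check{\mu}^\lambda_{\mathrm{NA}}(q):=-\infty$ otherwise. Write $\langle\cdot,\xi\rangle$ for the function $x\mapsto\langle x,\xi\rangle$ on $P$. For an integrable convex $q$ on $P$, the $\mu^\lambda_\xi$-Futaki invariant is $\mathrm{Fut}^\lambda_\xi(q):=\frac{2\pi\int_{\partial P}qe^{\langle\cdot,\xi\rangle}d\sigma-\lambda\int_Pq\langle\cdot,\xi\rangle e^{\langle\cdot,\xi\rangle}d\mu}{\int_Pe^{\langle\cdot,\xi\rangle}d\mu}-\bar{s}^\lambda_\xi\frac{\int_Pqe^{\langle\cdot,\xi\rangle}d\mu}{\int_Pe^{\langle\cdot,\xi\rangle}d\mu}$, where $\bar{s}^\lambda_\xi:=\frac{2\pi\int_{\partial P}e^{\langle\cdot,\xi\rangle}d\sigma-\lambda\int_P\langle\cdot,\xi\rangle e^{\langle\cdot,\xi\rangle}d\mu}{\int_Pe^{\langle\cdot,\xi\rangle}d\mu}$. $(X,L)$ is toric $\mu^\lambda_\xi$K-semistable if $\mathrm{Fut}^\lambda_\xi(q)\ge0$ for every rational piecewise affine convex function $q=\max_{i=1,\dots,m}\ell_i$ on $P$, with $\ell_i$ affine functions on $\mathfrak{t}^\vee$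 having rational linear part and rational constant term. *)

theory Defs
  imports "HOL-Analysis.Analysis"
begin

text \<open>Lattice M = Z^n inside t-dual = R^n (type real^'n); t = R^n, pairing = inner product.\<close>

definition lattice_pt :: "real^'n \<Rightarrow> bool" where
  "lattice_pt z \<longleftrightarrow> (\<forall>i. z $ i \<in> \<int>)"

definition rational_pt :: "real^'n \<Rightarrow> bool" where
  "rational_pt z \<longleftrightarrow> (\<forall>i. z $ i \<in> \<rat>)"

definition facets :: "(real^'n) set \<Rightarrow> (real^'n) set set" where
  "facets P = {Q. Q face_of P \<and> aff_dim Q = int CARD('n) - 1}"

definition facet_dir :: "(real^'n) set \<Rightarrow> (real^'n) set" where
  "facet_dir Q = {x - y | x y. x \<in> affine hull Q \<and> y \<in> affine hull Q}"

definition is_lattice_basis :: "(real^'n) set \<Rightarrow> (nat \<Rightarrow> real^'n) \<Rightarrow> bool" where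
  "is_lattice_basis Q b \<longleftrightarrow>
     (\<forall>i<CARD('n) - 1. lattice_pt (b i) \<and> b i \<in> facet_dir Q) \<and>
     inj_on b {..<CARD('n) - 1} \<and> independent (b ` {..<CARD('n) - 1}) \<and>
     (\<forall>z. lattice_pt z \<and> z \<in> facet_dir Q \<longrightarrow>
        (\<exists>c::nat \<Rightarrow> int. z = (\<Sum>i<CARD('n) - 1. of_int (c i) *\<^sub>R b i)))"

text \<open>An affine chart R^(n-1) -> W sending Z^(n-1) onto a translate of the lattice W \<inter> M;
  the unit cube goes to a fundamental domain, so Lebesgue measure on R^(n-1) pushes forward
  to the normalized Lebesgue measure on W.\<close>
definition facet_param :: "(real^'n) set \<Rightarrow> (real^'n) \<times> (nat \<Rightarrow> real^'n)" where
  "facet_param Q = (SOME pb. fst pb \<in> Q \<and> is_lattice_basis Q (snd pb))"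

definition facet_map :: "(real^'n) set \<Rightarrow> (nat \<Rightarrow> real) \<Rightarrow> real^'n" where
  "facet_map Q y = fst (facet_param Q) + (\<Sum>i<CARD('n) - 1. y i *\<^sub>R snd (facet_param Q) i)"

definition facet_space :: "(real^'n) itself \<Rightarrow> (nat \<Rightarrow> real) measure" where
  "facet_space _ = PiM {..<CARD('n) - 1} (\<lambda>_. lborel)"

definition facet_pre :: "(real^'n) set \<Rightarrow> (nat \<Rightarrow> real) set" where
  "facet_pre Q = {y \<in> space (facet_space TYPE(real^'n)). facet_map Q y \<in> Q}"

definition bdry_nn_integral :: "(real^'n) set \<Rightarrow> (real^'n \<Rightarrow> ennreal) \<Rightarrow> ennreal" where
  "bdry_nn_integral P f =
     (\<Sum>Q\<in>facets P. set_nn_integral (facet_space TYPE(real^'n)) (facet_pre Q) (\<lambda>y. f (facet_map Q y)))"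

definition bdry_integral :: "(real^'n) set \<Rightarrow> (real^'n \<Rightarrow> real) \<Rightarrow> real" where
  "bdry_integral P f =
     (\<Sum>Q\<in>facets P. set_lebesgue_integral (facet_space TYPE(real^'n)) (facet_pre Q) (\<lambda>y. f (facet_map Q y)))"

definition int_P :: "(real^'n) set \<Rightarrow> (real^'n \<Rightarrow> real) \<Rightarrow> real" where
  "int_P P f = set_lebesgue_integral lborel P f"

definition nn_int_P :: "(real^'n) set \<Rightarrow> (real^'n \<Rightarrow> ennreal) \<Rightarrow> ennreal" where
  "nn_int_P P f = set_nn_integral lborel P f"

definition eexp :: "ereal \<Rightarrow> ennreal" where
  "eexp x = (case x of ereal r \<Rightarrow> ennreal (exp r) | PInfty \<Rightarrow> \<infinity> | MInfty \<Rightarrow> 0)"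

definition convex_on_ereal :: "(real^'n) set \<Rightarrow> (real^'n \<Rightarrow> ereal) \<Rightarrow> bool" where
  "convex_on_ereal P q \<longleftrightarrow> (\<forall>x\<in>P. \<forall>y\<in>P. \<forall>t::real. 0 \<le> t \<and> t \<le> 1 \<longrightarrow>
      q ((1 - t) *\<^sub>R x + t *\<^sub>R y) \<le> ereal (1 - t) * q x + ereal t * q y)"

definition lsc_on_ereal :: "(real^'n) set \<Rightarrow> (real^'n \<Rightarrow> ereal) \<Rightarrow> bool" where
  "lsc_on_ereal P q \<longleftrightarrow> (\<forall>x\<in>P. q x \<le> Liminf (at x within P) q)"

definition E1 :: "(real^'n) set \<Rightarrow> (real^'n \<Rightarrow> ereal) \<Rightarrow> bool" where
  "E1 P q \<longleftrightarrow> (\<forall>x\<in>P. q x \<noteq> -\<infinity>) \<and> convex_on_ereal P q \<and> lsc_on_ereal P q \<and>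
     nn_int_P P (\<lambda>x. eexp (q x)) < \<infinity>"

definition Zq :: "(real^'n) set \<Rightarrow> (real^'n \<Rightarrow> ereal) \<Rightarrow> ennreal" where
  "Zq P q = nn_int_P P (\<lambda>x. eexp (q x))"

definition sigma_num :: "(real^'n) set \<Rightarrow> (real^'n \<Rightarrow> ereal) \<Rightarrow> ereal" where
  "sigma_num P q =
    (let g = (\<lambda>x. (ereal (real CARD('n)) + q x) * enn2ereal (eexp (q x))) in
      enn2ereal (nn_int_P P (\<lambda>x. e2ennreal (g x))) - enn2ereal (nn_int_P P (\<lambda>x. e2ennreal (- g x))))"

definition bsigma :: "(real^'n) set \<Rightarrow> (real^'n \<Rightarrow> ereal) \<Rightarrow> ereal" where
  "bsigma P q = sigma_num P q / enn2ereal (Zq P q) - ereal (ln (enn2real (Zq P q)))"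

definition muNA :: "(real^'n) set \<Rightarrow> (real^'n \<Rightarrow> ereal) \<Rightarrow> ereal" where
  "muNA P q = - ereal (2 * pi) * enn2ereal (bdry_nn_integral P (\<lambda>x. eexp (q x))) / enn2ereal (Zq P q)"

text \<open>Convention: if \<integral>_P e^q d\<mu> = 0 the quantities are undefined; we set the value to -\<infinity>.\<close>
definition muNA_lambda :: "(real^'n) set \<Rightarrow> real \<Rightarrow> (real^'n \<Rightarrow> ereal) \<Rightarrow> ereal" where
  "muNA_lambda P lam q =
     (if Zq P q = 0 then -\<infinity>
      else if bsigma P q < \<infinity> then muNA P q + ereal lam * bsigma P q else -\<infinity>)"

definition sbar :: "(real^'n) set \<Rightarrow> real \<Rightarrow> real^'n \<Rightarrow> real" where
  "sbar P lam xi =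
     (2 * pi * bdry_integral P (\<lambda>x. exp (x \<bullet> xi)) - lam * int_P P (\<lambda>x. (x \<bullet> xi) * exp (x \<bullet> xi)))
     / int_P P (\<lambda>x. exp (x \<bullet> xi))"

definition Fut :: "(real^'n) set \<Rightarrow> real \<Rightarrow> real^'n \<Rightarrow> (real^'n \<Rightarrow> real) \<Rightarrow> real" where
  "Fut P lam xi q =
     (2 * pi * bdry_integral P (\<lambda>x. q x * exp (x \<bullet> xi))
        - lam * int_P P (\<lambda>x. q x * (x \<bullet> xi) * exp (x \<bullet> xi))) / int_P P (\<lambda>x. exp (x \<bullet> xi))
     - sbar P lam xi * (int_P P (\<lambda>x. q x * exp (x \<bullet> xi)) / int_P P (\<lambda>x. exp (x \<bullet> xi)))"

definition toric_muK_semistable :: "(real^'n) set \<Rightarrow> real \<Rightarrow> real^'n \<Rightarrow> bool" where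
  "toric_muK_semistable P lam xi \<longleftrightarrow>
     (\<forall>(m::nat) (a::nat \<Rightarrow> real^'n) (c::nat \<Rightarrow> real).
        m \<ge> 1 \<and> (\<forall>i<m. rational_pt (a i) \<and> c i \<in> \<rat>) \<longrightarrow>
        Fut P lam xi (\<lambda>x. Max ((\<lambda>i. a i \<bullet> x + c i) ` {..<m})) \<ge> 0)"

end

theory Submission
  imports Defs
begin

text \<open>For \<open>q \<in> E1 P\<close> the function \<open>w = exp (q - \<xi>)\<close> is again convex and lower semicontinuous,
  and it is nonnegative, so on \<open>P\<close> it is the increasing limit of maxima of finitely many rational
  affine functions. Hence semistability gives \<open>Fut w \<ge> 0\<close> by monotone and dominated convergence.
  Since \<open>w * exp \<xi> = exp q\<close>, this compares the boundary term of \<open>q\<close> with that of \<open>\<xi>\<close>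
  up to a multiple of \<open>\<integral>\<xi> exp q\<close>, and for \<open>\<lambda> \<le> 0\<close> the Gibbs inequality for the two densities
  \<open>exp q\<close> and \<open>exp \<xi>\<close> controls the remaining entropy term. Conversely, the derivative of the
  functional at \<open>\<xi>\<close> in the direction of a convex \<open>u\<close> is \<open>- Fut u\<close>.\<close>

section \<open>Lattice bases and finiteness of the facet measures\<close>

text \<open>For \<open>lam = 0\<close> the functional is a quotient of two linear functionals of
  \<open>exp q\<close>. Since \<open>Fut\<close> is linear, its nonnegativity at
  \<open>exp (q - xi)\<close>, divided by the mass of \<open>exp q\<close>, is already the global
  inequality, so a first-order condition at \<open>xi\<close> suffices and no concavity along paths
  is involved. For \<open>lam < 0\<close> the mean of \<open>xi\<close> under the density
  \<open>exp q\<close> is left over; it cancels between this inequality and the Gibbs inequality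
  multiplied by \<open>lam\<close>. The obstacle is regularity: \<open>q\<close> may be infinite at
  points of \<open>P\<close>, is arbitrary outside \<open>P\<close>, is not assumed Borel, and its
  entropy or boundary integral may diverge. The countable supremum of affine functions supplies a
  Borel version of \<open>exp q\<close>, whose logarithm \<open>f\<close> is real and equals
  \<open>q\<close> almost everywhere. Divergent cases have value minus infinity; all others reduce
  to the real number \<open>energy lam f\<close>. The chart of a facet is a
  \<open>SOME\<close>-choice, so a lattice basis must be constructed before the boundary measure can
  be shown to be finite.\<close>

lemma diff_closed_int_mult:
  fixes G :: "'a::real_vector set"
  assumes "0 \<in> G" and diff: "\<And>x y. x \<in> G \<Longrightarrow> y \<in> G \<Longrightarrow> x - y \<in> G" and "w \<in> G"
  shows "of_int a *\<^sub>R w \<in> G"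
proof (induction a rule: int_induct[where k = 0])
  case base
  show ?case using assms by simp
next
  case (step1 i)
  have "- w \<in> G" using diff[OF assms(1) assms(3)] by simp
  from diff[OF step1(2) this] show ?case by (simp add: algebra_simps)
next
  case (step2 i)
  from diff[OF step2(2) assms(3)] show ?case by (simp add: algebra_simps)
qed

text \<open>Induction on the coordinates that may be nonzero: the kernel of the coordinate
  \<open>i\<close> on \<open>G\<close> has a basis by induction, its image is a subgroup of the
  integers, hence cyclic, and a lift of a generator completes the basis. Independence is over the
  reals, so the cardinality of \<open>B\<close> is a real dimension.\<close>

lemma lattice_subgroup_basis:
  fixes G :: "(real^'n) set"
  assumes "finite I" and "0 \<in> G" and "\<And>x y. x \<in> G \<Longrightarrow> y \<in> G \<Longrightarrow> x - y \<in> G"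
    and "\<And>x. x \<in> G \<Longrightarrow> lattice_pt x" and "\<And>x i. x \<in> G \<Longrightarrow> i \<notin> I \<Longrightarrow> x $ i = 0"
  shows "\<exists>B. finite B \<and> B \<subseteq> G \<and> independent B \<and>
    (\<forall>z\<in>G. \<exists>c::real^'n \<Rightarrow> int. z = (\<Sum>b\<in>B. of_int (c b) *\<^sub>R b))"
  using assms
proof (induction I arbitrary: G rule: finite_induct)
  case empty
  have "z = 0" if "z \<in> G" for z using empty.prems(4)[OF that] by (simp add: vec_eq_iff)
  then show ?case by (intro exI[of _ "{}"]) (auto simp: independent_empty)
next
  case (insert i I)
  define G' where "G' = {x \<in> G. x $ i = 0}"
  have "\<exists>B. finite B \<and> B \<subseteq> G' \<and> independent B \<and>
    (\<forall>z\<in>G'. \<exists>c::real^'n \<Rightarrow> int. z = (\<Sum>b\<in>B. of_int (c b) *\<^sub>R b))"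
  proof (rule insert.IH)
    show "0 \<in> G'" using insert.prems(1) by (simp add: G'_def)
    show "x - y \<in> G'" if "x \<in> G'" "y \<in> G'" for x y
      using that insert.prems(2) by (simp add: G'_def)
    show "lattice_pt x" if "x \<in> G'" for x using that insert.prems(3) by (simp add: G'_def)
    show "x $ j = 0" if "x \<in> G'" "j \<notin> I" for x j
      using that insert.prems(4)[of x j] by (cases "j = i") (auto simp: G'_def)
  qed
  then obtain B' where B': "finite B'" "B' \<subseteq> G'" "independent B'"
    and spn: "\<And>z. z \<in> G' \<Longrightarrow> \<exists>c::real^'n \<Rightarrow> int. z = (\<Sum>b\<in>B'. of_int (c b) *\<^sub>R b)"
    by blast
  show ?case
  proof (cases "\<forall>x\<in>G. x $ i = 0")
    case True
    then have "G' = G" by (auto simp: G'_def)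
    then show ?thesis using B' spn by blast
  next
    case False
    then obtain x where x: "x \<in> G" "x $ i \<noteq> 0" by blast
    obtain m where m: "x $ i = of_int m"
      using insert.prems(3)[OF x(1)] by (auto simp: lattice_pt_def elim: Ints_cases)
    have "\<exists>k::nat. k > 0 \<and> (\<exists>w\<in>G. w $ i = real k)"
    proof (cases "m > 0")
      case True
      then show ?thesis using x m by (intro exI[of _ "nat m"]) auto
    next
      case False
      then have "m < 0" using x m by (cases "m = 0") auto
      moreover have "- x \<in> G" using insert.prems(2)[OF insert.prems(1) x(1)] by simp
      ultimately show ?thesis using m
        by (intro exI[of _ "nat (- m)"] conjI bexI[of _ "- x"]) auto
    qed
    then obtain k0 :: nat where k0: "k0 > 0 \<and> (\<exists>w\<in>G. w $ i = real k0)" by blast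
    \<comment> \<open>The positive generator of the image of \<open>G\<close> under the coordinate
      \<open>i\<close>.\<close>
    define k where "k = (LEAST k::nat. k > 0 \<and> (\<exists>w\<in>G. w $ i = real k))"
    have k: "k > 0" "\<exists>w\<in>G. w $ i = real k"
      using LeastI[of "\<lambda>k. k > 0 \<and> (\<exists>w\<in>G. w $ i = real k)", OF k0] unfolding k_def by blast+
    have kmin: "k \<le> j" if "j > 0" "\<exists>w\<in>G. w $ i = real j" for j
      unfolding k_def using that by (intro Least_le) blast
    obtain w where w: "w \<in> G" "w $ i = real k" using k by blast
    \<comment> \<open>The old basis lies in the hyperplane where the coordinate \<open>i\<close>
      vanishes, and \<open>w\<close> does not.\<close>
    have "span B' \<subseteq> {x. x $ i = 0}"
      using B'(2) by (intro span_minimal) (auto simp: G'_def subspace_def)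
    then have "w \<notin> span B'" using w k by auto
    then have ind: "independent (insert w B')" and wB: "w \<notin> B'"
      using B'(3) by (auto simp: independent_insert span_base)
    have "\<exists>c::real^'n \<Rightarrow> int. z = (\<Sum>b\<in>insert w B'. of_int (c b) *\<^sub>R b)" if z: "z \<in> G" for z
    proof -
      obtain m where m: "z $ i = of_int m"
        using insert.prems(3)[OF z] by (auto simp: lattice_pt_def elim: Ints_cases)
      \<comment> \<open>Euclidean division: after subtracting \<open>a\<close> copies of
        \<open>w\<close> the coordinate \<open>i\<close> is a remainder below \<open>k\<close>,
        which must vanish by minimality of \<open>k\<close>.\<close>
      define a where "a = m div int k"
      define z' where "z' = z - of_int a *\<^sub>R w"
      have z'G: "z' \<in> G" unfolding z'_def
        using insert.prems(2)[OF z] diff_closed_int_mult[of G w a, OF insert.prems(1,2) w(1)] by simp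
      have "m = int k * a + m mod int k" unfolding a_def by simp
      then have "real_of_int m = real k * of_int a + of_int (m mod int k)"
        by (metis of_int_add of_int_mult of_int_of_nat_eq)
      then have zi: "z' $ i = of_int (m mod int k)"
        unfolding z'_def using m w(2) by simp
      have "m mod int k = 0"
      proof (rule ccontr)
        assume "m mod int k \<noteq> 0"
        then have p: "m mod int k > 0" using k(1) by (smt (verit) pos_mod_sign of_nat_0_less_iff)
        have "k \<le> nat (m mod int k)"
          using p zi z'G by (intro kmin) auto
        moreover have "m mod int k < int k" using k(1) by simp
        ultimately show False using p by linarith
      qed
      then have "z' \<in> G'" using z'G zi by (simp add: G'_def)
      then obtain c :: "real^'n \<Rightarrow> int" where c: "z' = (\<Sum>b\<in>B'. of_int (c b) *\<^sub>R b)"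
        using spn by blast
      have "(\<Sum>b\<in>insert w B'. of_int ((c(w := a)) b) *\<^sub>R b)
          = of_int a *\<^sub>R w + (\<Sum>b\<in>B'. of_int ((c(w := a)) b) *\<^sub>R b)"
        using B'(1) wB by simp
      also have "(\<Sum>b\<in>B'. of_int ((c(w := a)) b) *\<^sub>R b) = z'"
        unfolding c using wB by (intro sum.cong) auto
      finally show ?thesis by (intro exI[of _ "c(w := a)"]) (simp add: z'_def)
    qed
    then show ?thesis using B' w ind
      by (intro exI[of _ "insert w B'"]) (auto simp: G'_def)
  qed
qed

lemma facet_dir_eq_span:
  assumes "p \<in> Q"
  shows "facet_dir Q = span ((\<lambda>x. x - p) ` Q)"
proof
  have *: "affine hull Q = (+) p ` span ((\<lambda>x. x - p) ` Q)"
    using affine_hull_span_gen[of p Q] hull_inc[OF assms] by (simp add: image_def)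
  show "facet_dir Q \<subseteq> span ((\<lambda>x. x - p) ` Q)"
  proof
    fix z assume "z \<in> facet_dir Q"
    then obtain x y where "z = (p + x) - (p + y)"
      and xy: "x \<in> span ((\<lambda>x. x - p) ` Q)" "y \<in> span ((\<lambda>x. x - p) ` Q)"
      unfolding facet_dir_def * by blast
    then show "z \<in> span ((\<lambda>x. x - p) ` Q)" using span_diff[OF xy] by simp
  qed
  show "span ((\<lambda>x. x - p) ` Q) \<subseteq> facet_dir Q"
  proof
    fix z assume "z \<in> span ((\<lambda>x. x - p) ` Q)"
    then have "p + z \<in> affine hull Q" unfolding * by blast
    moreover have "p \<in> affine hull Q" using assms by (simp add: hull_inc)
    moreover have "z = (p + z) - p" by simp
    ultimately show "z \<in> facet_dir Q" unfolding facet_dir_def by blast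
  qed
qed

text \<open>A facet is the hull of some of the lattice points \<open>T\<close>, so the differences
  \<open>x - p\<close> are lattice vectors spanning its direction. The subgroup \<open>G\<close> of
  all lattice vectors in that direction therefore has full real rank, and its basis has exactly
  \<open>CARD('n) - 1\<close> elements. This makes the \<open>SOME\<close>-choice in
  \<open>facet_param\<close> meaningful.\<close>

lemma facet_lattice_basis:
  fixes S :: "(real^'n) set"
  assumes "finite S" and "\<forall>z\<in>S. lattice_pt z" and Q: "Q \<in> facets (convex hull S)"
  shows "\<exists>b. is_lattice_basis Q b"
proof -
  have "Q face_of convex hull S" and ad: "aff_dim Q = int CARD('n) - 1"
    using Q by (auto simp: facets_def)
  then obtain T where T: "T \<subseteq> S" "Q = convex hull T"
    using face_of_convex_hull_subset[of S Q] finite_imp_compact[OF assms(1)] by blast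
  have "Q \<noteq> {}" using ad by (auto simp: aff_dim_empty[of Q] simp flip: aff_dim_empty)
  then obtain p where p: "p \<in> T" using T by fastforce
  have pQ: "p \<in> Q" using T p by (simp add: hull_inc)
  have TQ: "T \<subseteq> Q" using T by (simp add: hull_subset)
  have "affine hull Q = affine hull T" using T by simp
  then have fd: "facet_dir Q = span ((\<lambda>x. x - p) ` T)"
    using facet_dir_eq_span[OF p] by (simp add: facet_dir_def)
  define G where "G = {z. lattice_pt z \<and> z \<in> facet_dir Q}"
  have "\<exists>B. finite B \<and> B \<subseteq> G \<and> independent B \<and>
      (\<forall>z\<in>G. \<exists>c::real^'n \<Rightarrow> int. z = (\<Sum>b\<in>B. of_int (c b) *\<^sub>R b))"
    by (rule lattice_subgroup_basis[of UNIV])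
      (auto simp: G_def fd lattice_pt_def intro: span_zero span_diff)
  then obtain B where B: "finite B" "B \<subseteq> G" "independent B"
    and spn: "\<And>z. z \<in> G \<Longrightarrow> \<exists>c::real^'n \<Rightarrow> int. z = (\<Sum>b\<in>B. of_int (c b) *\<^sub>R b)"
    by blast
  have "(\<lambda>x. x - p) ` T \<subseteq> G"
    using assms(2) T(1) p by (auto simp: G_def fd lattice_pt_def subset_iff intro: span_base)
  moreover have "G \<subseteq> span B"
  proof
    fix z assume "z \<in> G"
    then obtain c :: "real^'n \<Rightarrow> int" where "z = (\<Sum>b\<in>B. of_int (c b) *\<^sub>R b)" using spn by blast
    then show "z \<in> span B" by (simp add: span_sum span_scale span_base)
  qed
  ultimately have "span ((\<lambda>x. x - p) ` T) \<subseteq> span B"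
    by (meson order_trans span_minimal subspace_span)
  moreover have "span B \<subseteq> span ((\<lambda>x. x - p) ` T)"
    using B(2) by (intro span_minimal) (auto simp: G_def fd)
  ultimately have "dim ((\<lambda>x. x - p) ` T) = card B"
    by (metis B(3) dim_span dim_eq_card_independent subset_antisym)
  moreover have "aff_dim Q = int (dim ((\<lambda>x. x - p) ` T))"
  proof -
    have "aff_dim Q = aff_dim T" using T by (simp add: aff_dim_convex_hull)
    also have "\<dots> = int (dim ((\<lambda>x. x - p) ` T))"
      using aff_dim_eq_dim_subtract[of p T] p by (simp add: hull_inc)
    finally show ?thesis .
  qed
  ultimately have card: "card B = CARD('n) - 1" using ad by linarith
  obtain b where b: "bij_betw b {..<CARD('n) - 1} B"
    using ex_bij_betw_nat_finite[OF B(1)] card by (auto simp: atLeast0LessThan)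
  have "is_lattice_basis Q b"
    unfolding is_lattice_basis_def
  proof (intro conjI allI impI)
    show "lattice_pt (b i)" "b i \<in> facet_dir Q" if "i < CARD('n) - 1" for i
      using that b B(2) by (auto simp: G_def bij_betw_def)
    show "inj_on b {..<CARD('n) - 1}" using b by (simp add: bij_betw_def)
    show "independent (b ` {..<CARD('n) - 1})" using b B(3) by (simp add: bij_betw_def)
    fix z assume "lattice_pt z \<and> z \<in> facet_dir Q"
    then obtain c :: "real^'n \<Rightarrow> int" where "z = (\<Sum>b\<in>B. of_int (c b) *\<^sub>R b)"
      using spn by (auto simp: G_def)
    also have "\<dots> = (\<Sum>i<CARD('n) - 1. of_int (c (b i)) *\<^sub>R b i)"
      by (rule sum.reindex_bij_betw[OF b, symmetric])
    finally show "\<exists>c::nat \<Rightarrow> int. z = (\<Sum>i<CARD('n) - 1. of_int (c i) *\<^sub>R b i)"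
      by (intro exI[of _ "\<lambda>i. c (b i)"])
  qed
  then show ?thesis by (rule exI[of _ b])
qed

text \<open>The restriction of the boundary measure to \<open>Q\<close>, carried to the ambient
  space so that facet terms and volume terms obey the same lemmas.\<close>

definition facet_measure :: "(real^'n) set \<Rightarrow> (real^'n) measure" where
  "facet_measure Q =
    distr (density (facet_space TYPE(real^'n)) (indicator (facet_pre Q))) borel (facet_map Q)"

lemma facet_map_measurable [measurable]:
  "facet_map (Q::(real^'n) set) \<in> borel_measurable (facet_space TYPE(real^'n))"
  unfolding facet_map_def facet_space_def by measurable

lemma facet_pre_measurable:
  fixes Q :: "(real^'n) set"
  assumes "Q \<in> sets borel"
  shows "facet_pre Q \<in> sets (facet_space TYPE(real^'n))"
  using measurable_sets[OF facet_map_measurable assms]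
  by (simp add: facet_pre_def vimage_def Int_def conj_commute)

text \<open>The coordinates of the chart are linear functionals of the displacement from the base
  point, hence bounded on the bounded set \<open>Q\<close>; the preimage of \<open>Q\<close> thus
  lies in a box.\<close>

lemma facet_pre_finite:
  fixes S :: "(real^'n) set"
  assumes "finite S" and "\<forall>z\<in>S. lattice_pt z" and Q: "Q \<in> facets (convex hull S)"
  shows "emeasure (facet_space TYPE(real^'n)) (facet_pre Q) < \<infinity>"
proof -
  let ?N = "CARD('n) - 1"
  interpret product_sigma_finite "\<lambda>_::nat. lborel :: real measure" by standard
  have "Q face_of convex hull S" and ad: "aff_dim Q = int CARD('n) - 1"
    using Q by (auto simp: facets_def)
  then have "Q \<subseteq> convex hull S" by (simp add: face_of_imp_subset)
  then have bQ: "bounded Q"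
    by (meson assms(1) bounded_convex_hull bounded_subset finite_imp_bounded)
  have "Q \<noteq> {}" using ad by (auto simp flip: aff_dim_empty)
  then have "\<exists>pb. fst pb \<in> Q \<and> is_lattice_basis Q (snd pb)"
    using facet_lattice_basis[OF assms] by auto
  then have pb: "fst (facet_param Q) \<in> Q" "is_lattice_basis Q (snd (facet_param Q))"
    unfolding facet_param_def by (metis (mono_tags, lifting) someI_ex)+
  define p where "p = fst (facet_param Q)"
  define b where "b = snd (facet_param Q)"
  have inj: "inj_on b {..<?N}" and ind: "independent (b ` {..<?N})"
    using pb(2) by (auto simp: b_def is_lattice_basis_def)
  obtain R where R: "\<And>x. x \<in> Q \<Longrightarrow> norm x \<le> R" using bQ by (auto simp: bounded_iff)
  have "\<exists>C. \<forall>y \<in> facet_pre Q. \<bar>y i\<bar> \<le> C" if i: "i < ?N" for i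
  proof -
    \<comment> \<open>The functional dual to \<open>b i\<close>; it reads off the coordinate
      \<open>y i\<close>.\<close>
    obtain g :: "real^'n \<Rightarrow> real" where g: "linear g"
      "\<And>x. x \<in> b ` {..<?N} \<Longrightarrow> g x = (if x = b i then 1 else 0)"
      using linear_independent_extend[OF ind, of "\<lambda>x. if x = b i then 1 else 0"] by auto
    obtain K where K: "\<And>x. \<bar>g x\<bar> \<le> norm x * K" "0 \<le> K"
      using bounded_linear.nonneg_bounded[of g] g(1) linear_conv_bounded_linear by (metis real_norm_def)
    have "\<bar>y i\<bar> \<le> (R + norm p) * K" if y: "y \<in> facet_pre Q" for y
    proof -
      let ?v = "\<Sum>j<?N. y j *\<^sub>R b j"
      have "p + ?v \<in> Q" using y by (simp add: facet_pre_def facet_map_def p_def b_def)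
      from R[OF this] have "norm ?v \<le> R + norm p"
        using norm_triangle_ineq4[of "p + ?v" p] by simp
      moreover have "g ?v = y i"
      proof -
        have "g ?v = (\<Sum>j<?N. y j * g (b j))"
          using g(1) by (simp add: linear_sum linear_scale)
        also have "\<dots> = (\<Sum>j<?N. if j = i then y j else 0)"
          using g(2) inj i by (intro sum.cong) (auto simp: inj_on_eq_iff)
        finally show ?thesis using i by simp
      qed
      ultimately show ?thesis using K(1)[of ?v] mult_right_mono[of "norm ?v" "R + norm p" K] K(2) by simp
    qed
    then show ?thesis by blast
  qed
  then obtain C where C: "\<And>i y. i < ?N \<Longrightarrow> y \<in> facet_pre Q \<Longrightarrow> \<bar>y i\<bar> \<le> C i" by metis
  have "facet_pre Q \<subseteq> PiE {..<?N} (\<lambda>i. {- C i..C i})"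
  proof
    fix y assume y: "y \<in> facet_pre Q"
    then have "y \<in> extensional {..<?N}"
      by (auto simp: facet_pre_def facet_space_def space_PiM PiE_def)
    then show "y \<in> PiE {..<?N} (\<lambda>i. {- C i..C i})"
      using C[OF _ y] by (auto simp: PiE_def abs_le_iff Pi_iff minus_le_iff)
  qed
  then have "emeasure (facet_space TYPE(real^'n)) (facet_pre Q)
      \<le> emeasure (facet_space TYPE(real^'n)) (PiE {..<?N} (\<lambda>i. {- C i..C i}))"
    by (rule emeasure_mono) (auto simp: facet_space_def intro!: sets_PiM_I_finite)
  also have "\<dots> = (\<Prod>i<?N. emeasure lborel {- C i..C i})"
    unfolding facet_space_def by (rule emeasure_PiM) auto
  also have "\<dots> < \<infinity>"
    by (simp add: less_top[symmetric] ennreal_prod_eq_top emeasure_lborel_cbox_finite emeasure_lborel_Icc_eq)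
  finally show ?thesis .
qed

section \<open>Convex functions as suprema of rational affine functions\<close>

lemma rational_vector_approx:
  fixes v :: "real^'n"
  assumes "d > 0"
  shows "\<exists>r. rational_pt r \<and> norm (r - v) \<le> d"
proof -
  have pos: "d / real CARD('n) > 0" using assms by simp
  have "\<forall>i. \<exists>q\<in>\<rat>. \<bar>q - v $ i\<bar> \<le> d / real CARD('n)"
  proof
    fix i
    obtain q where "q \<in> \<rat>" "v $ i < q" "q < v $ i + d / real CARD('n)"
      using Rats_dense_in_real[of "v $ i" "v $ i + d / real CARD('n)"] pos by auto
    then show "\<exists>q\<in>\<rat>. \<bar>q - v $ i\<bar> \<le> d / real CARD('n)" by (intro bexI[of _ q]) auto
  qed
  then obtain f where f: "\<And>i. f i \<in> \<rat>" "\<And>i. \<bar>f i - v $ i\<bar> \<le> d / real CARD('n)" by metis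
  have "norm ((\<chi> i. f i) - v) \<le> (\<Sum>i\<in>UNIV. \<bar>((\<chi> i. f i) - v) $ i\<bar>)" by (rule norm_le_l1_cart)
  also have "\<dots> \<le> (\<Sum>i\<in>(UNIV::'n set). d / real CARD('n))" using f by (intro sum_mono) auto
  also have "\<dots> = d" by simp
  finally show ?thesis using f by (intro exI[of _ "\<chi> i. f i"]) (auto simp: rational_pt_def)
qed

lemma countable_rational_pts: "countable {a::real^'n. rational_pt a}"
  using countable_vector[of "\<lambda>_. \<rat>"] by (simp add: rational_pt_def countable_rat)

text \<open>Strict separation of the point \<open>(x0, t0)\<close> from the epigraph, solved for the
  vertical coordinate. Since \<open>ennreal\<close> sends negative reals to \<open>0\<close>, the
  minorant is constrained only where it is positive.\<close>

lemma affine_minorant: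
  fixes w :: "real^'n \<Rightarrow> ennreal"
  assumes conv: "convex {(x, t::real). x \<in> P \<and> 0 \<le> t \<and> w x \<le> ennreal t}" (is "convex ?E")
    and clo: "closed {(x, t::real). x \<in> P \<and> 0 \<le> t \<and> w x \<le> ennreal t}"
    and x0: "x0 \<in> P" and t0: "0 \<le> t0" "ennreal t0 < w x0"
  shows "\<exists>a c. (\<forall>x\<in>P. ennreal (a \<bullet> x + c) \<le> w x) \<and> t0 < a \<bullet> x0 + c"
proof -
  have "(x0, t0) \<notin> ?E" using t0 by auto
  then obtain v b where v: "v \<bullet> (x0, t0) < b" "\<And>z. z \<in> ?E \<Longrightarrow> b < v \<bullet> z"
    using separating_hyperplane_closed_point[OF conv clo, of "(x0, t0)"] by blast
  obtain a B where [simp]: "v = (a, B)" by (cases v)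
  show ?thesis
  proof (cases "?E = {}")
    \<comment> \<open>With an empty epigraph \<open>w\<close> is infinite on all of
      \<open>P\<close>, and any constant above \<open>t0\<close> serves.\<close>
    case True
    have "w x = \<infinity>" if "x \<in> P" for x
    proof (rule ccontr)
      assume "w x \<noteq> \<infinity>"
      then have "(x, enn2real (w x)) \<in> ?E" using that by (simp add: less_top)
      then show False using True by blast
    qed
    then show ?thesis by (intro exI[of _ 0] exI[of _ "t0 + 1"]) simp
  next
    case False
    then obtain x t where xt: "x \<in> P" "0 \<le> t" "w x \<le> ennreal t" by blast
    have B0: "B \<ge> 0"
    proof (rule ccontr)
      \<comment> \<open>The epigraph is closed under moving upward. With a negative vertical
        coefficient \<open>B\<close>, the shift \<open>s\<close> would carry a point of it across
        the hyperplane.\<close>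
      assume n: "\<not> B \<ge> 0"
      define s where "s = max 0 ((a \<bullet> x + B * t - b) / (- B))"
      have "(x, t + s) \<in> ?E"
        using xt by (auto simp: s_def intro: order_trans ennreal_leI)
      from v(2)[OF this] have "b < a \<bullet> x + B * (t + s)" by simp
      moreover have "(a \<bullet> x + B * t - b) / (- B) \<le> s" by (simp add: s_def)
      then have "a \<bullet> x + B * t - b \<le> s * (- B)" using n by (simp add: field_simps)
      ultimately show False by (simp add: algebra_simps)
    qed
    define g where "g = b - (a \<bullet> x0 + B * t0)"
    have g: "g > 0" using v(1) by (simp add: g_def)
    \<comment> \<open>The separating hyperplane may be vertical (\<open>B = 0\<close>); as \<open>t \<ge> 0\<close> on the epigraph, it can be tilted.\<close>
    define e where "e = g / (t0 + 1)"
    have e: "e > 0" "e * t0 < g" using g t0 by (auto simp: e_def field_simps)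
    define b' where "b' = B + e"
    have b': "b' > 0" using B0 e by (simp add: b'_def)
    have below: "(b - a \<bullet> x) / b' \<le> t" if "(x, t) \<in> ?E" for x t
    proof -
      have "b < a \<bullet> x + B * t" "0 \<le> e * t" using v(2)[OF that] that e by auto
      then have "b - a \<bullet> x \<le> t * b'" by (simp add: b'_def algebra_simps)
      then show ?thesis using b' by (simp add: field_simps)
    qed
    have aff: "((- 1 / b') *\<^sub>R a) \<bullet> x + b / b' = (b - a \<bullet> x) / b'" for x
      using b' by (simp add: field_simps)
    have "ennreal ((b - a \<bullet> x) / b') \<le> w x" if "x \<in> P" for x
    proof (cases "w x = \<infinity>")
      case False
      then have fin: "ennreal (enn2real (w x)) = w x" by (simp add: less_top)
      then have "(x, enn2real (w x)) \<in> ?E" using that by simp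
      from below[OF this] have "ennreal ((b - a \<bullet> x) / b') \<le> ennreal (enn2real (w x))"
        by (rule ennreal_leI)
      then show ?thesis unfolding fin .
    qed simp
    moreover have "t0 < (b - a \<bullet> x0) / b'"
    proof -
      have "t0 * b' < b - a \<bullet> x0" using e(2) by (simp add: b'_def g_def algebra_simps)
      then show ?thesis using b' by (simp add: field_simps)
    qed
    ultimately show ?thesis
      by (intro exI[of _ "(- 1 / b') *\<^sub>R a"] exI[of _ "b / b'"]) (unfold aff, blast)
  qed
qed

text \<open>The gap \<open>g\<close> at \<open>x0\<close> pays for the rounding. As \<open>P\<close>
  has radius at most \<open>R\<close>, changing the slope by \<open>g / (4 * R)\<close> moves values
  by at most \<open>g / 4\<close>; lowering the constant by more than \<open>g / 4\<close> restores
  the minorant, and by less than \<open>g / 2\<close> leaves more than \<open>g / 4\<close> of the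
  gap.\<close>

lemma rational_affine_minorant:
  fixes w :: "real^'n \<Rightarrow> ennreal"
  assumes conv: "convex {(x, t::real). x \<in> P \<and> 0 \<le> t \<and> w x \<le> ennreal t}"
    and clo: "closed {(x, t::real). x \<in> P \<and> 0 \<le> t \<and> w x \<le> ennreal t}"
    and x0: "x0 \<in> P" and t0: "0 \<le> t0" "ennreal t0 < w x0" and bP: "bounded P"
  shows "\<exists>a c. rational_pt a \<and> c \<in> \<rat> \<and> (\<forall>x\<in>P. ennreal (a \<bullet> x + c) \<le> w x) \<and> t0 < a \<bullet> x0 + c"
proof -
  obtain a c where ac: "\<And>x. x \<in> P \<Longrightarrow> ennreal (a \<bullet> x + c) \<le> w x" "t0 < a \<bullet> x0 + c"
    using affine_minorant[OF conv clo x0 t0] by blast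
  obtain R where R: "R > 0" "\<And>x. x \<in> P \<Longrightarrow> norm x \<le> R" using bP by (auto simp: bounded_pos)
  define g where "g = a \<bullet> x0 + c - t0"
  have g: "g > 0" using ac by (simp add: g_def)
  obtain a' where a': "rational_pt a'" "norm (a' - a) \<le> g / (4 * R)"
    using rational_vector_approx[of "g / (4 * R)" a] g R by auto
  obtain c' where c': "c' \<in> \<rat>" "c - g / 2 < c'" "c' < c - g / 4"
    using Rats_dense_in_real[of "c - g / 2" "c - g / 4"] g by auto
  have close: "\<bar>a' \<bullet> x - a \<bullet> x\<bar> \<le> g / 4" if "x \<in> P" for x
  proof -
    have "\<bar>a' \<bullet> x - a \<bullet> x\<bar> \<le> norm (a' - a) * norm x"
      using Cauchy_Schwarz_ineq2[of "a' - a" x] by (simp add: inner_diff_left)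
    also have "\<dots> \<le> g / (4 * R) * R" using a' R that g by (intro mult_mono) auto
    finally show ?thesis using R by simp
  qed
  show ?thesis
  proof (intro exI conjI ballI)
    fix x assume x: "x \<in> P"
    have "a' \<bullet> x + c' \<le> a \<bullet> x + c" using close[OF x] c' by linarith
    then show "ennreal (a' \<bullet> x + c') \<le> w x" using ac(1)[OF x] ennreal_leI order_trans by blast
  next
    show "t0 < a' \<bullet> x0 + c'" using abs_ge_minus_self[of "a' \<bullet> x0 - a \<bullet> x0"] close[OF x0] c' g
      by (simp add: g_def field_simps)
  qed (use a' c' in auto)
qed

text \<open>Rational coefficients serve twice: the family becomes countable, so finite maxima form a
  sequence, and each maximum is a test function of the semistability condition.\<close>

lemma convex_lsc_eq_Sup_rational_affine:
  fixes w :: "real^'n \<Rightarrow> ennreal"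
  assumes conv: "convex {(x, t::real). x \<in> P \<and> 0 \<le> t \<and> w x \<le> ennreal t}"
    and clo: "closed {(x, t::real). x \<in> P \<and> 0 \<le> t \<and> w x \<le> ennreal t}"
    and bP: "bounded P"
  obtains a :: "nat \<Rightarrow> real^'n" and c :: "nat \<Rightarrow> real" where
    "\<And>i. rational_pt (a i)" "\<And>i. c i \<in> \<rat>" "a 0 = 0" "c 0 = 0"
    "\<And>x. x \<in> P \<Longrightarrow> w x = (SUP i. ennreal (a i \<bullet> x + c i))"
proof -
  define A where "A = {ac::(real^'n) \<times> real. rational_pt (fst ac) \<and> snd ac \<in> \<rat> \<and>
    (\<forall>x\<in>P. ennreal (fst ac \<bullet> x + snd ac) \<le> w x)}"
  have "A \<subseteq> {a. rational_pt a} \<times> \<rat>" by (auto simp: A_def)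
  then have cA: "countable A"
    using countable_subset countable_SIGMA countable_rational_pts countable_rat by metis
  have zA: "(0, 0) \<in> A" by (simp add: A_def rational_pt_def)
  \<comment> \<open>Zero is put first so that every maximum over an initial segment of indices is
    nonnegative.\<close>
  define ac where "ac i = (case i of 0 \<Rightarrow> (0, 0) | Suc j \<Rightarrow> from_nat_into A j)" for i
  have acA: "ac i \<in> A" for i
    using zA from_nat_into[of A] by (cases i) (auto simp: ac_def)
  have surj: "\<exists>i. ac i = z" if "z \<in> A" for z
    using from_nat_into_surj[OF cA that] by (metis ac_def nat.case(2))
  show ?thesis
  proof (rule that[of "\<lambda>i. fst (ac i)" "\<lambda>i. snd (ac i)"])
    show "rational_pt (fst (ac i))" "snd (ac i) \<in> \<rat>" for i using acA[of i] by (auto simp: A_def)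
    show "fst (ac 0) = 0" "snd (ac 0) = 0" by (auto simp: ac_def)
    fix x assume x: "x \<in> P"
    show "w x = (SUP i. ennreal (fst (ac i) \<bullet> x + snd (ac i)))"
    proof (rule antisym)
      show "(SUP i. ennreal (fst (ac i) \<bullet> x + snd (ac i))) \<le> w x"
        using acA x by (intro SUP_least) (auto simp: A_def)
      show "w x \<le> (SUP i. ennreal (fst (ac i) \<bullet> x + snd (ac i)))"
      proof (rule dense_le)
        fix y assume y: "y < w x"
        then obtain t where t: "y = ennreal t" "0 \<le> t" by (cases y) auto
        obtain a c where "rational_pt a" "c \<in> \<rat>" "\<forall>x\<in>P. ennreal (a \<bullet> x + c) \<le> w x" "t < a \<bullet> x + c"
          using rational_affine_minorant[OF conv clo x t(2) _ bP] y t by blast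
        then obtain i where "ac i = (a, c)" "t < a \<bullet> x + c" using surj[of "(a, c)"] by (auto simp: A_def)
        then have "y \<le> ennreal (fst (ac i) \<bullet> x + snd (ac i))" using t by (simp add: ennreal_leI)
        also have "\<dots> \<le> (SUP i. ennreal (fst (ac i) \<bullet> x + snd (ac i)))" by (rule SUP_upper) simp
        finally show "y \<le> (SUP i. ennreal (fst (ac i) \<bullet> x + snd (ac i)))" .
      qed
    qed
  qed
qed

section \<open>Convexity and lower semicontinuity of the twisted exponential\<close>

text \<open>This is \<open>exp (q - \<xi>)\<close>, with value \<open>\<infinity>\<close> where \<open>q = \<infinity>\<close>.\<close>

definition twist :: "real^'n \<Rightarrow> (real^'n \<Rightarrow> ereal) \<Rightarrow> real^'n \<Rightarrow> ennreal" where
  "twist xi q x = eexp (q x) * ennreal (exp (- (x \<bullet> xi)))"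

lemma eexp_pos: "x \<noteq> -\<infinity> \<Longrightarrow> eexp x > 0"
  by (cases x) (auto simp: eexp_def)

text \<open>Taking logarithms turns statements about the epigraph of \<open>twist\<close> into
  statements about \<open>q\<close>. Positive heights suffice, because \<open>twist\<close> is
  positive wherever \<open>q\<close> is not minus infinity.\<close>

lemma twist_le_iff:
  assumes "t > 0"
  shows "twist xi q x \<le> ennreal t \<longleftrightarrow> q x \<le> ereal (ln t + x \<bullet> xi)"
proof (cases "q x")
  case (real r)
  have "twist xi q x = ennreal (exp (r - x \<bullet> xi))"
    by (simp add: twist_def eexp_def real exp_diff exp_minus field_simps flip: ennreal_mult)
  then show ?thesis using ln_ge_iff[OF assms, of "r - x \<bullet> xi"] assms real by (auto simp: algebra_simps)
qed (auto simp: twist_def eexp_def ennreal_mult_eq_top_iff ennreal_top_mult top_unique)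

lemma twist_pos: "q x \<noteq> -\<infinity> \<Longrightarrow> twist xi q x > 0"
  using eexp_pos[of "q x"] by (simp add: twist_def ennreal_zero_less_mult_iff)

text \<open>A log-convex function is convex: the logarithm of \<open>twist\<close> is
  \<open>q\<close> minus a linear function, and concavity of \<open>ln\<close> bounds the mean of
  the logarithms of two heights by the logarithm of their mean.\<close>

lemma twist_epigraph_convex:
  assumes E: "E1 P q" and P: "convex P"
  shows "convex {(x, t::real). x \<in> P \<and> 0 \<le> t \<and> twist xi q x \<le> ennreal t}"
proof (rule convexI)
  let ?E = "{(x, t::real). x \<in> P \<and> 0 \<le> t \<and> twist xi q x \<le> ennreal t}"
  fix z z' and u v :: real
  assume "z \<in> ?E" "z' \<in> ?E" and uv: "0 \<le> u" "0 \<le> v" "u + v = 1"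
  then obtain x s y t where z: "z = (x, s)" "z' = (y, t)"
    and x: "x \<in> P" "0 \<le> s" "twist xi q x \<le> ennreal s"
    and y: "y \<in> P" "0 \<le> t" "twist xi q y \<le> ennreal t"
    by blast
  have s: "s > 0" using twist_pos[of q x xi] E x by (cases "s = 0") (auto simp: E1_def)
  have t: "t > 0" using twist_pos[of q y xi] E y by (cases "t = 0") (auto simp: E1_def)
  have st: "u * s + v * t > 0" using s t uv
    by (metis add_pos_nonneg add_nonneg_pos less_eq_real_def mult_nonneg_nonneg mult_pos_pos add.right_neutral zero_neq_one)
  have u: "u = 1 - v" "v \<le> 1" using uv by auto
  have "q (u *\<^sub>R x + v *\<^sub>R y) \<le> ereal u * q x + ereal v * q y"
    using E x(1) y(1) uv u unfolding E1_def convex_on_ereal_def u(1) by blast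
  also have "\<dots> \<le> ereal u * ereal (ln s + x \<bullet> xi) + ereal v * ereal (ln t + y \<bullet> xi)"
    using x y uv twist_le_iff[OF s, of xi q x] twist_le_iff[OF t, of xi q y]
    by (intro add_mono ereal_mult_left_mono) auto
  also have "\<dots> = ereal ((u * ln s + v * ln t) + (u *\<^sub>R x + v *\<^sub>R y) \<bullet> xi)"
    by (simp add: algebra_simps inner_add_left)
  also have "\<dots> \<le> ereal (ln (u * s + v * t) + (u *\<^sub>R x + v *\<^sub>R y) \<bullet> xi)"
    using concave_onD[OF ln_concave, of v s t] s t uv u by simp
  finally show "u *\<^sub>R z + v *\<^sub>R z' \<in> ?E"
    using convexD[OF P x(1) y(1) uv] st by (simp add: z twist_le_iff[OF st])
qed

text \<open>If the limit point were below the graph, a level \<open>t1\<close> would fit strictly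
  between \<open>t0\<close> and \<open>twist xi q x0\<close>. Lower semicontinuity keeps
  \<open>q\<close> above some \<open>r > ln t1 + x0 \<bullet> xi\<close> near \<open>x0\<close>,
  whereas \<open>t n < t1\<close> forces \<open>q (x n)\<close> below a quantity tending to
  \<open>ln t1 + x0 \<bullet> xi\<close>.\<close>

lemma twist_epigraph_closed:
  assumes E: "E1 P q" and P: "closed P"
  shows "closed {(x, t::real). x \<in> P \<and> 0 \<le> t \<and> twist xi q x \<le> ennreal t}"
proof -
  let ?E = "{(x, t::real). x \<in> P \<and> 0 \<le> t \<and> twist xi q x \<le> ennreal t}"
  have "z \<in> ?E" if f: "\<forall>n. f n \<in> ?E" and lim: "f \<longlonglongrightarrow> z" for f z
  proof -
    obtain x0 t0 where z: "z = (x0, t0)" by (cases z)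
    define x where "x n = fst (f n)" for n
    define t where "t n = snd (f n)" for n
    have xt: "x n \<in> P" "0 \<le> t n" "twist xi q (x n) \<le> ennreal (t n)" for n
      using f by (auto simp: x_def t_def case_prod_beta)
    have lx: "x \<longlonglongrightarrow> x0" and lt: "t \<longlonglongrightarrow> t0"
      using tendsto_fst[OF lim] tendsto_snd[OF lim] by (auto simp: x_def[abs_def] t_def[abs_def] z)
    have x0: "x0 \<in> P" using closed_sequentially[OF P] xt lx by blast
    have t0: "0 \<le> t0" using LIMSEQ_le_const[OF lt] xt by blast
    have "twist xi q x0 \<le> ennreal t0"
    proof (rule ccontr)
      assume "\<not> twist xi q x0 \<le> ennreal t0"
      then obtain s where s: "ennreal t0 < s" "s < twist xi q x0" using dense not_le by metis
      then obtain t1 where t1: "s = ennreal t1" "t0 < t1"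
        using t0 by (cases s) (auto simp: ennreal_less_iff)
      have t1p: "t1 > 0" using t0 t1 by simp
      have "ereal (ln t1 + x0 \<bullet> xi) < q x0"
        using s(2) twist_le_iff[OF t1p, of xi q x0] t1 by (simp flip: not_le)
      then obtain r where r: "ereal (ln t1 + x0 \<bullet> xi) < ereal r" "ereal r < q x0"
        using ereal_dense2 by blast
      have "ereal r < Liminf (at x0 within P) q"
        using E x0 r(2) unfolding E1_def lsc_on_ereal_def by (meson order_less_le_trans)
      then have "\<forall>\<^sub>F y in at x0 within P. ereal r < q y" by (rule less_LiminfD)
      then obtain S where S: "open S" "x0 \<in> S" "\<And>y. y \<in> S \<Longrightarrow> y \<noteq> x0 \<Longrightarrow> y \<in> P \<Longrightarrow> ereal r < q y"
        unfolding eventually_at_topological by blast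
      have "\<forall>\<^sub>F n in sequentially. x n \<in> S" using topological_tendstoD[OF lx S(1,2)] .
      moreover have "\<forall>\<^sub>F n in sequentially. t n < t1" using order_tendstoD(2)[OF lt t1(2)] .
      moreover have "((\<lambda>n. ln t1 + x n \<bullet> xi) \<longlongrightarrow> ln t1 + x0 \<bullet> xi) sequentially"
        by (intro tendsto_intros lx)
      then have "\<forall>\<^sub>F n in sequentially. ln t1 + x n \<bullet> xi < r"
        using order_tendstoD(2) r(1) by fastforce
      ultimately have "\<forall>\<^sub>F n in sequentially. False"
      proof eventually_elim
        case (elim n)
        \<comment> \<open>The \<open>Liminf\<close> runs over a punctured neighbourhood, so the
          terms with \<open>x n = x0\<close> are treated separately.\<close>
        have "ereal r < q (x n)" using S(3)[of "x n"] xt(1)[of n] elim(1) r(2) by (cases "x n = x0") auto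
        moreover have "twist xi q (x n) \<le> ennreal t1"
          using xt(3)[of n] elim(2) by (meson ennreal_leI less_imp_le order_trans)
        then have "q (x n) \<le> ereal (ln t1 + x n \<bullet> xi)" using twist_le_iff[OF t1p] by blast
        ultimately have "ereal r < ereal (ln t1 + x n \<bullet> xi)" by (rule order_less_le_trans)
        then show False using elim(3) by simp
      qed
      then show False by simp
    qed
    then show ?thesis using x0 t0 z by simp
  qed
  then show ?thesis unfolding closed_sequential_limits by blast
qed

section \<open>Integration over the polytope and its facets\<close>

definition body_measure :: "(real^'n) set \<Rightarrow> (real^'n) measure" where
  "body_measure P = density lborel (indicator P)"

text \<open>The common features of \<open>body_measure P\<close> and of each
  \<open>facet_measure Q\<close> on which the limit and differentiation lemmas rest.\<close>

definition concentrated :: "(real^'n) set \<Rightarrow> (real^'n) measure \<Rightarrow> bool" where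
  "concentrated P M \<longleftrightarrow> finite_measure M \<and> sets M = sets borel \<and> (AE x in M. x \<in> P)"

lemma concentratedD:
  assumes "concentrated P M"
  shows "finite_measure M" "sets M = sets borel" "AE x in M. x \<in> P"
  using assms by (auto simp: concentrated_def)

lemma AE_density_indicator:
  assumes "A \<in> sets M"
  shows "(AE x in density M (indicator A). R x) \<longleftrightarrow> (AE x in M. x \<in> A \<longrightarrow> R x)"
proof -
  have "0 < (indicator A x :: ennreal) \<longleftrightarrow> x \<in> A" for x by (simp split: split_indicator)
  then show ?thesis using assms by (simp add: AE_density)
qed

lemma concentrated_body_measure:
  assumes "compact P"
  shows "concentrated P (body_measure P)"
proof -
  have [measurable]: "P \<in> sets borel" using assms by (simp add: borel_compact)
  have "emeasure (body_measure P) (space (body_measure P)) = emeasure lborel P"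
    by (simp add: body_measure_def emeasure_density)
  also have "\<dots> < \<infinity>" using emeasure_bounded_finite compact_imp_bounded[OF assms] by auto
  finally have "finite_measure (body_measure P)" by (intro finite_measureI) auto
  moreover have "AE x in body_measure P. x \<in> P"
    unfolding body_measure_def by (simp add: AE_density_indicator)
  moreover have "sets (body_measure P) = sets borel" by (simp add: body_measure_def)
  ultimately show ?thesis unfolding concentrated_def by blast
qed

lemma emeasure_body_measure_pos:
  assumes "compact P" "interior P \<noteq> {}"
  shows "emeasure (body_measure P) (space (body_measure P)) \<noteq> 0"
proof
  have [measurable]: "P \<in> sets borel" using assms by (simp add: borel_compact)
  assume "emeasure (body_measure P) (space (body_measure P)) = 0"
  then have "emeasure lborel P = 0" by (simp add: body_measure_def emeasure_density)
  then have "P \<in> null_sets lebesgue" by (metis \<open>P \<in> sets borel\<close> null_setsI null_sets_completionI sets_lborel)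
  then have "negligible P" by (simp add: negligible_iff_null_sets)
  then have "negligible (interior P)" using negligible_subset interior_subset by blast
  then show False using assms(2) open_not_negligible open_interior by blast
qed

text \<open>The integrand \<open>f\<close> built from \<open>q\<close> is not known to be
  measurable, so its integral is computed from a Borel function \<open>g\<close> that agrees with it
  almost everywhere on \<open>P\<close>.\<close>

lemma nn_int_P_eq:
  assumes "P \<in> sets borel" and [measurable]: "g \<in> borel_measurable borel"
    and "AE x in body_measure P. f x = g x"
  shows "nn_int_P P f = (\<integral>\<^sup>+x. g x \<partial>body_measure P)"
proof -
  have [measurable]: "P \<in> sets borel" by fact
  have "AE x in lborel. x \<in> P \<longrightarrow> f x = g x"
    using assms(3) unfolding body_measure_def by (simp add: AE_density_indicator)
  then have "nn_int_P P f = (\<integral>\<^sup>+x. g x * indicator P x \<partial>lborel)"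
    unfolding nn_int_P_def by (intro nn_integral_cong_AE) (auto split: split_indicator)
  also have "\<dots> = (\<integral>\<^sup>+x. g x \<partial>body_measure P)"
    by (simp add: body_measure_def nn_integral_density mult.commute)
  finally show ?thesis .
qed

lemma int_P_eq:
  fixes f :: "real^'n \<Rightarrow> real"
  assumes [measurable]: "P \<in> sets borel" "f \<in> borel_measurable borel"
  shows "int_P P f = (\<integral>x. f x \<partial>body_measure P)"
  unfolding int_P_def body_measure_def set_lebesgue_integral_def
  using integral_density[of f lborel "indicator P"] by (simp add: ennreal_indicator)

lemma facet_nn_integral_eq:
  fixes f g :: "real^'n \<Rightarrow> ennreal"
  assumes Q: "Q \<in> sets borel" and [measurable]: "g \<in> borel_measurable borel"
    and "AE x in facet_measure Q. f x = g x"
  shows "set_nn_integral (facet_space TYPE(real^'n)) (facet_pre Q) (\<lambda>y. f (facet_map Q y))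
    = (\<integral>\<^sup>+x. g x \<partial>facet_measure Q)"
proof -
  let ?M = "facet_space TYPE(real^'n)"
  have [measurable]: "facet_pre Q \<in> sets ?M" by (rule facet_pre_measurable[OF Q])
  have "AE y in density ?M (indicator (facet_pre Q)). f (facet_map Q y) = g (facet_map Q y)"
    using assms(3) unfolding facet_measure_def by (rule AE_distrD[rotated]) simp
  then have "AE y in ?M. y \<in> facet_pre Q \<longrightarrow> f (facet_map Q y) = g (facet_map Q y)"
    by (simp add: AE_density_indicator)
  then have "set_nn_integral ?M (facet_pre Q) (\<lambda>y. f (facet_map Q y))
     = (\<integral>\<^sup>+y. g (facet_map Q y) * indicator (facet_pre Q) y \<partial>?M)"
    by (intro nn_integral_cong_AE) (auto split: split_indicator)
  also have "\<dots> = (\<integral>\<^sup>+x. g x \<partial>facet_measure Q)"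
    by (simp add: facet_measure_def nn_integral_distr nn_integral_density mult.commute)
  finally show ?thesis .
qed

lemma facet_integral_eq:
  fixes f :: "real^'n \<Rightarrow> real"
  assumes Q: "Q \<in> sets borel" and [measurable]: "f \<in> borel_measurable borel"
  shows "set_lebesgue_integral (facet_space TYPE(real^'n)) (facet_pre Q) (\<lambda>y. f (facet_map Q y))
    = (\<integral>x. f x \<partial>facet_measure Q)"
proof -
  let ?M = "facet_space TYPE(real^'n)"
  have [measurable]: "facet_pre Q \<in> sets ?M" by (rule facet_pre_measurable[OF Q])
  show ?thesis
    unfolding facet_measure_def set_lebesgue_integral_def
    using integral_density[of "\<lambda>y. f (facet_map Q y)" ?M "indicator (facet_pre Q)"]
    by (simp add: ennreal_indicator integral_distr)
qed

lemma finite_facets: "polytope P \<Longrightarrow> finite (facets P)"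
  unfolding facets_def using finite_polytope_faces[of P] by (rule rev_finite_subset) auto

lemma facets_closed:
  assumes "polytope P" "Q \<in> facets P"
  shows "closed Q"
  using assms face_of_polytope_polytope polytope_imp_closed unfolding facets_def by blast

lemma concentrated_facet_measure:
  fixes S :: "(real^'n) set"
  assumes S: "finite S" "\<forall>z\<in>S. lattice_pt z" and Q: "Q \<in> facets (convex hull S)"
  shows "concentrated (convex hull S) (facet_measure Q)"
proof -
  let ?M = "facet_space TYPE(real^'n)"
  have "polytope (convex hull S)" using S by (auto simp: polytope_def)
  then have Qb: "Q \<in> sets borel" using facets_closed Q by (auto intro: borel_closed)
  then have [measurable]: "facet_pre Q \<in> sets ?M" by (rule facet_pre_measurable)
  have QP: "Q \<subseteq> convex hull S" using Q by (auto simp: facets_def dest: face_of_imp_subset)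
  have "(\<integral>\<^sup>+x. 1 \<partial>facet_measure Q) = emeasure ?M (facet_pre Q)"
    using facet_nn_integral_eq[OF Qb, of "\<lambda>_. 1" "\<lambda>_. 1"] by simp
  then have "finite_measure (facet_measure Q)"
    using facet_pre_finite[OF S Q] by (intro finite_measureI) simp
  moreover have "AE x in facet_measure Q. x \<in> convex hull S"
  proof -
    have "AE x in facet_measure Q. x \<in> Q"
      unfolding facet_measure_def using Qb
      by (subst AE_distr_iff) (auto simp: AE_density_indicator facet_pre_def)
    then show ?thesis by eventually_elim (use QP in auto)
  qed
  moreover have "sets (facet_measure Q) = sets borel" by (simp add: facet_measure_def)
  ultimately show ?thesis
    unfolding concentrated_def by blast
qed

section \<open>Limits and derivatives of integrals against concentrated measures\<close>

lemma concentrated_integrable: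
  fixes f :: "real^'n \<Rightarrow> real"
  assumes c: "concentrated P M" and [measurable]: "f \<in> borel_measurable borel"
    and b: "\<And>x. x \<in> P \<Longrightarrow> \<bar>f x\<bar> \<le> C"
  shows "integrable M f"
  using concentratedD[OF c] b
  by (intro finite_measure.integrable_const_bound[of M f C]) auto

lemma concentrated_integrable_continuous:
  fixes f :: "real^'n \<Rightarrow> real"
  assumes c: "concentrated P M" and P: "compact P" and f: "continuous_on UNIV f"
  shows "integrable M f"
proof -
  have "compact (f ` P)" using P f continuous_on_subset compact_continuous_image by blast
  from compact_imp_bounded[OF this]
  obtain C where "\<And>x. x \<in> P \<Longrightarrow> \<bar>f x\<bar> \<le> C"
    by (auto simp: bounded_iff)
  then show ?thesis
    using concentrated_integrable[OF c borel_measurable_continuous_onI[OF f]] by blast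
qed

text \<open>The weight \<open>k\<close> may change sign, as \<open>x \<bullet> xi\<close> does, so
  monotone convergence alone is not enough. It is used to identify the limit \<open>h\<close> as
  integrable, and \<open>C * h\<close> then dominates the weighted sequence.\<close>

lemma mono_limit_integral:
  fixes V :: "nat \<Rightarrow> real^'n \<Rightarrow> real"
  assumes c: "concentrated P M"
    and [measurable]: "\<And>m. V m \<in> borel_measurable borel" "k \<in> borel_measurable borel"
    and inc: "\<And>x. incseq (\<lambda>m. V m x)" and V0: "\<And>m x. 0 \<le> V m x"
    and fin: "(\<integral>\<^sup>+x. (SUP m. ennreal (V m x)) \<partial>M) < \<infinity>"
    and h: "AE x in M. (SUP m. ennreal (V m x)) = ennreal (h x)" "\<And>x. h x \<ge> 0"
    and [measurable]: "h \<in> borel_measurable borel"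
    and k: "\<And>x. x \<in> P \<Longrightarrow> \<bar>k x\<bar> \<le> C"
  shows "integrable M h" "integrable M (\<lambda>x. k x * h x)"
    "(\<lambda>m. \<integral>x. k x * V m x \<partial>M) \<longlonglongrightarrow> (\<integral>x. k x * h x \<partial>M)"
proof -
  note [measurable_cong] = concentratedD(2)[OF c]
  have "(\<integral>\<^sup>+x. ennreal (h x) \<partial>M) < \<infinity>"
    using nn_integral_cong_AE[OF h(1)] fin by simp
  then show int: "integrable M h" using h(2) by (intro integrableI_nonneg) auto
  have bnd: "AE x in M. norm (k x * h x) \<le> norm (C * h x)"
    using concentratedD(3)[OF c]
  proof eventually_elim
    case (elim x)
    have "\<bar>k x\<bar> * \<bar>h x\<bar> \<le> \<bar>C\<bar> * \<bar>h x\<bar>"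
      using k[OF elim] by (intro mult_right_mono) auto
    then show ?case by (simp add: abs_mult)
  qed
  show "integrable M (\<lambda>x. k x * h x)"
    by (rule Bochner_Integration.integrable_bound[of M "\<lambda>x. C * h x"]) (use int bnd in auto)
  have lim: "(\<lambda>m. V m x) \<longlonglongrightarrow> h x \<and> (\<forall>m. V m x \<le> h x)"
    if "(SUP m. ennreal (V m x)) = ennreal (h x)" for x
  proof -
    have "incseq (\<lambda>m. ennreal (V m x))" using inc[of x] by (auto simp: incseq_def ennreal_leI)
    then have "(\<lambda>m. ennreal (V m x)) \<longlonglongrightarrow> ennreal (h x)" using LIMSEQ_SUP that by metis
    then have l: "(\<lambda>m. V m x) \<longlonglongrightarrow> h x" using V0 h(2) by (simp add: tendsto_ennreal_iff)
    then show ?thesis using incseq_le[OF inc l] by blast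
  qed
  show "(\<lambda>m. \<integral>x. k x * V m x \<partial>M) \<longlonglongrightarrow> (\<integral>x. k x * h x \<partial>M)"
  proof (rule integral_dominated_convergence[where w = "\<lambda>x. C * h x"])
    show "AE x in M. (\<lambda>m. k x * V m x) \<longlonglongrightarrow> k x * h x"
      using h(1) by eventually_elim (auto intro!: tendsto_intros dest: lim)
    show "AE x in M. norm (k x * V m x) \<le> C * h x" for m
      using h(1) concentratedD(3)[OF c]
    proof eventually_elim
      case (elim x)
      have "\<bar>k x\<bar> * V m x \<le> C * h x"
        using k[OF elim(2)] lim[OF elim(1)] V0[of m x] by (intro mult_mono) auto
      then show ?case using V0[of m x] by (simp add: abs_mult)
    qed
  qed (use int in auto)
qed

lemma exp_quadratic_bound:
  fixes x :: real
  assumes "\<bar>x\<bar> \<le> 1"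
  shows "\<bar>exp x - 1 - x\<bar> \<le> x\<^sup>2"
proof (cases "x \<ge> 0")
  case True
  then show ?thesis using exp_bound[of x] exp_ge_add_one_self[of x] zero_le_power2[of x] assms by linarith
next
  case False
  define y where "y = - x"
  have y: "y \<ge> 0" using False by (simp add: y_def)
  \<comment> \<open>The product shows that \<open>1 - y + y\<^sup>2\<close> is at least the
    reciprocal of the quadratic Taylor polynomial of \<open>exp y\<close>, hence at least
    \<open>exp (- y)\<close>.\<close>
  have "1 \<le> (1 - y + y\<^sup>2) * (1 + y + y\<^sup>2 / 2)"
  proof -
    have "(1 - y + y\<^sup>2) * (1 + y + y\<^sup>2 / 2) = 1 + (y\<^sup>2 + y^3 + y^4) / 2"
      by (simp add: field_simps power2_eq_square power3_eq_cube power4_eq_xxxx)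
    then show ?thesis using y by simp
  qed
  also have "\<dots> \<le> (1 - y + y\<^sup>2) * exp y"
  proof (rule mult_left_mono)
    show "1 + y + y\<^sup>2 / 2 \<le> exp y" using exp_lower_Taylor_quadratic[OF y] by simp
    show "0 \<le> 1 - y + y\<^sup>2" using assms by (simp add: y_def)
  qed
  finally have "exp (- y) \<le> 1 - y + y\<^sup>2" by (simp add: exp_minus field_simps)
  then have "exp x \<le> 1 + x + x\<^sup>2" by (simp add: y_def)
  then show ?thesis using exp_ge_add_one_self[of x] zero_le_power2[of x] by linarith
qed

lemma has_derivative_of_quadratic_bound:
  fixes F :: "real \<Rightarrow> real"
  assumes "d > 0" and b: "\<And>t. \<bar>t\<bar> \<le> d \<Longrightarrow> \<bar>F t - F 0 - t * D\<bar> \<le> C * t\<^sup>2"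
  shows "(F has_real_derivative D) (at 0)"
proof -
  have "((\<lambda>t. (F t - F 0) / t - D) \<longlongrightarrow> 0) (at 0)"
  proof (rule Lim_null_comparison)
    have "\<forall>\<^sub>F t in at (0::real). \<bar>t\<bar> < d \<and> t \<noteq> 0"
      using assms(1) by (auto simp: eventually_at intro!: exI[of _ d])
    then show "\<forall>\<^sub>F t in at 0. norm ((F t - F 0) / t - D) \<le> C * \<bar>t\<bar>"
    proof eventually_elim
      case (elim t)
      have "\<bar>(F t - F 0) / t - D\<bar> = \<bar>F t - F 0 - t * D\<bar> / \<bar>t\<bar>"
        using elim by (simp add: field_simps flip: abs_divide)
      also have "\<dots> \<le> C * t\<^sup>2 / \<bar>t\<bar>" using b[of t] elim by (intro divide_right_mono) auto
      also have "\<dots> = C * \<bar>t\<bar>"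
      proof -
        have "t\<^sup>2 / \<bar>t\<bar> = \<bar>t\<bar>" using elim by (simp add: power2_eq_square abs_if)
        then show ?thesis by (metis times_divide_eq_right)
      qed
      finally show ?case by simp
    qed
    show "((\<lambda>t. C * \<bar>t\<bar>) \<longlongrightarrow> 0) (at 0)" by (auto intro!: tendsto_eq_intros)
  qed
  then show ?thesis by (simp add: DERIV_def LIM_zero_iff)
qed

text \<open>Differentiation under the integral sign with an explicit remainder: for
  \<open>|t| \<le> 1 / G\<close> the exponent \<open>t * g x\<close> stays in the unit interval
  around \<open>0\<close> on \<open>P\<close>, where the second-order error of \<open>exp\<close> is
  at most its square.\<close>

lemma integral_exp_derivative:
  fixes f g k :: "real^'n \<Rightarrow> real"
  assumes c: "concentrated P M" and P: "compact P"
    and cont: "continuous_on UNIV f" "continuous_on UNIV g" "continuous_on UNIV k"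
  shows "((\<lambda>t. \<integral>x. k x * exp (f x + t * g x) \<partial>M) has_real_derivative
    (\<integral>x. k x * g x * exp (f x) \<partial>M)) (at 0)"
proof -
  have "compact (g ` P)" using P cont continuous_on_subset compact_continuous_image by blast
  from compact_imp_bounded[OF this]
  obtain G0 where G0: "\<And>x. x \<in> P \<Longrightarrow> \<bar>g x\<bar> \<le> G0"
    by (auto simp: bounded_iff)
  \<comment> \<open>The maximum with \<open>1\<close> makes the radius \<open>1 / G\<close> positive
    even when \<open>g\<close> vanishes on \<open>P\<close>.\<close>
  define G where "G = max 1 G0"
  have G: "G > 0" "\<And>x. x \<in> P \<Longrightarrow> \<bar>g x\<bar> \<le> G"
    using G0 by (auto simp: G_def intro: max.coboundedI2)
  note int = concentrated_integrable_continuous[OF c P]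
  have i1: "integrable M (\<lambda>x. k x * exp (f x + t * g x))" for t
    by (intro int continuous_intros cont)
  have i2: "integrable M (\<lambda>x. k x * g x * exp (f x))"
    by (intro int continuous_intros cont)
  have i3: "integrable M (\<lambda>x. \<bar>k x\<bar> * exp (f x) * (g x)\<^sup>2)"
    by (intro int continuous_intros cont)
  show ?thesis
  proof (rule has_derivative_of_quadratic_bound[of "1 / G" _ _ "\<integral>x. \<bar>k x\<bar> * exp (f x) * (g x)\<^sup>2 \<partial>M"])
    fix t :: real assume t: "\<bar>t\<bar> \<le> 1 / G"
    let ?r = "\<lambda>x. k x * exp (f x + t * g x) - k x * exp (f x + 0 * g x) - t * (k x * g x * exp (f x))"
    have eq: "(\<integral>x. k x * exp (f x + t * g x) \<partial>M) - (\<integral>x. k x * exp (f x + 0 * g x) \<partial>M)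
        - t * (\<integral>x. k x * g x * exp (f x) \<partial>M) = (\<integral>x. ?r x \<partial>M)"
      using i1[of t] i1[of 0] i2 by simp
    have "\<bar>\<integral>x. ?r x \<partial>M\<bar> \<le> (\<integral>x. \<bar>?r x\<bar> \<partial>M)" by (rule integral_abs_bound)
    also have "\<dots> \<le> (\<integral>x. t\<^sup>2 * (\<bar>k x\<bar> * exp (f x) * (g x)\<^sup>2) \<partial>M)"
    proof (rule integral_mono_AE)
      show "AE x in M. \<bar>?r x\<bar> \<le> t\<^sup>2 * (\<bar>k x\<bar> * exp (f x) * (g x)\<^sup>2)"
        using concentratedD(3)[OF c]
      proof eventually_elim
        case (elim x)
        have "\<bar>t * g x\<bar> \<le> 1 / G * G"
          unfolding abs_mult using t G elim by (intro mult_mono) auto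
        then have "\<bar>exp (t * g x) - 1 - t * g x\<bar> \<le> (t * g x)\<^sup>2"
          using G by (intro exp_quadratic_bound) simp
        then have "\<bar>k x * exp (f x)\<bar> * \<bar>exp (t * g x) - 1 - t * g x\<bar> \<le> \<bar>k x * exp (f x)\<bar> * (t * g x)\<^sup>2"
          by (rule mult_left_mono) simp
        moreover have "?r x = k x * exp (f x) * (exp (t * g x) - 1 - t * g x)"
          by (simp add: exp_add algebra_simps)
        ultimately show ?case by (simp add: abs_mult power_mult_distrib mult_ac)
      qed
    qed (use i1[of t] i1[of 0] i2 i3 in simp_all)
    also have "\<dots> = (\<integral>x. \<bar>k x\<bar> * exp (f x) * (g x)\<^sup>2 \<partial>M) * t\<^sup>2" by simp
    finally show "\<bar>(\<integral>x. k x * exp (f x + t * g x) \<partial>M) - (\<integral>x. k x * exp (f x + 0 * g x) \<partial>M)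
        - t * (\<integral>x. k x * g x * exp (f x) \<partial>M)\<bar> \<le> (\<integral>x. \<bar>k x\<bar> * exp (f x) * (g x)\<^sup>2 \<partial>M) * t\<^sup>2"
      unfolding eq .
  qed (use G in simp)
qed

section \<open>The functional on a lattice polytope\<close>

lemma e2ennreal_ereal: "e2ennreal (ereal r) = ennreal r"
  by (simp add: ennreal.abs_eq e2ennreal_def)

locale lattice_polytope =
  fixes S :: "(real^'n) set"
  assumes finite_S: "finite S" and lattice_S: "\<forall>z\<in>S. lattice_pt z"
    and interior_S: "interior (convex hull S) \<noteq> {}"
begin

abbreviation "P \<equiv> convex hull S"

abbreviation "bdry_int f \<equiv> (\<Sum>Q\<in>facets P. \<integral>x. f x \<partial>facet_measure Q)"

text \<open>The real value of \<open>muNA_lambda\<close> at a function represented by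
  \<open>f\<close>, once the mass, entropy and boundary integrals converge. The summand
  \<open>CARD('n)\<close> comes from the factor \<open>n + q\<close> in the numerator of
  \<open>bsigma\<close>.\<close>

definition energy :: "real \<Rightarrow> (real^'n \<Rightarrow> real) \<Rightarrow> real" where
  "energy lam f =
    - (2 * pi) * bdry_int (\<lambda>x. exp (f x)) / (\<integral>x. exp (f x) \<partial>body_measure P)
    + lam * (real CARD('n) + (\<integral>x. f x * exp (f x) \<partial>body_measure P) / (\<integral>x. exp (f x) \<partial>body_measure P)
             - ln (\<integral>x. exp (f x) \<partial>body_measure P))"

lemma polytope_P: "polytope P" using finite_S by (auto simp: polytope_def)

lemma compact_P: "compact P" using polytope_P polytope_imp_compact by blast

lemma P_borel [measurable]: "P \<in> sets borel" using compact_P by (simp add: borel_compact)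

lemma finite_facets_P: "finite (facets P)" using polytope_P by (rule finite_facets)

lemma facet_borel: "Q \<in> facets P \<Longrightarrow> Q \<in> sets borel"
  using facets_closed[OF polytope_P] by (auto intro: borel_closed)

lemmas conc_body = concentrated_body_measure[OF compact_P]
lemmas conc_facet = concentrated_facet_measure[OF finite_S lattice_S]

lemma partition_pos:
  fixes f :: "real^'n \<Rightarrow> real"
  assumes "integrable (body_measure P) (\<lambda>x. exp (f x))"
  shows "0 < (\<integral>x. exp (f x) \<partial>body_measure P)"
proof -
  have "(\<integral>x. exp (f x) \<partial>body_measure P) \<noteq> 0"
  proof
    assume "(\<integral>x. exp (f x) \<partial>body_measure P) = 0"
    then have "AE x in body_measure P. exp (f x) = 0"
      using integral_nonneg_eq_0_iff_AE[OF assms] by simp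
    then have "AE x in body_measure P. False" by simp
    then show False
      using emeasure_body_measure_pos[OF compact_P interior_S]
      by (simp add: AE_iff_null null_sets_def)
  qed
  moreover have "0 \<le> (\<integral>x. exp (f x) \<partial>body_measure P)" by (intro integral_nonneg_AE) simp
  ultimately show ?thesis by linarith
qed

lemma bdry_nn_integral_eq:
  assumes "g \<in> borel_measurable borel"
    and "\<And>Q. Q \<in> facets P \<Longrightarrow> AE x in facet_measure Q. f x = g x"
  shows "bdry_nn_integral P f = (\<Sum>Q\<in>facets P. \<integral>\<^sup>+x. g x \<partial>facet_measure Q)"
  unfolding bdry_nn_integral_def
  using assms by (intro sum.cong facet_nn_integral_eq facet_borel) auto

lemma bdry_integral_eq:
  assumes "f \<in> borel_measurable borel"
  shows "bdry_integral P f = bdry_int f"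
  unfolding bdry_integral_def
  using assms by (intro sum.cong facet_integral_eq facet_borel) auto

lemma Zq_eq:
  assumes [measurable]: "f \<in> borel_measurable borel"
    and q: "AE x in body_measure P. q x = ereal (f x)"
    and int: "integrable (body_measure P) (\<lambda>x. exp (f x))"
  shows "Zq P q = ennreal (\<integral>x. exp (f x) \<partial>body_measure P)"
proof -
  have "Zq P q = (\<integral>\<^sup>+x. ennreal (exp (f x)) \<partial>body_measure P)"
    unfolding Zq_def
  proof (rule nn_int_P_eq)
    show "AE x in body_measure P. eexp (q x) = ennreal (exp (f x))"
      using q by eventually_elim (simp add: eexp_def)
  qed auto
  also have "\<dots> = ennreal (\<integral>x. exp (f x) \<partial>body_measure P)"
    using int by (intro nn_integral_eq_integral) auto
  finally show ?thesis .
qed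

lemma sigma_num_eq:
  assumes [measurable]: "f \<in> borel_measurable borel"
    and q: "AE x in body_measure P. q x = ereal (f x)"
    and int: "integrable (body_measure P) (\<lambda>x. exp (f x))"
      "integrable (body_measure P) (\<lambda>x. f x * exp (f x))"
  shows "sigma_num P q = ereal (real CARD('n) * (\<integral>x. exp (f x) \<partial>body_measure P)
    + (\<integral>x. f x * exp (f x) \<partial>body_measure P))"
proof -
  let ?g = "\<lambda>x. (real CARD('n) + f x) * exp (f x)"
  have intg: "integrable (body_measure P) ?g" using int by (simp add: distrib_right)
  have 1: "nn_int_P P (\<lambda>x. e2ennreal ((ereal (real CARD('n)) + q x) * enn2ereal (eexp (q x))))
      = (\<integral>\<^sup>+x. ennreal (?g x) \<partial>body_measure P)"
  proof (rule nn_int_P_eq)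
    show "AE x in body_measure P. e2ennreal ((ereal (real CARD('n)) + q x) * enn2ereal (eexp (q x)))
        = ennreal (?g x)"
      using q by eventually_elim (simp add: eexp_def e2ennreal_ereal enn2ereal_ennreal)
  qed auto
  have 2: "nn_int_P P (\<lambda>x. e2ennreal (- ((ereal (real CARD('n)) + q x) * enn2ereal (eexp (q x)))))
      = (\<integral>\<^sup>+x. ennreal (- ?g x) \<partial>body_measure P)"
  proof (rule nn_int_P_eq)
    show "AE x in body_measure P. e2ennreal (- ((ereal (real CARD('n)) + q x) * enn2ereal (eexp (q x))))
        = ennreal (- ?g x)"
      using q by eventually_elim (simp add: eexp_def e2ennreal_ereal enn2ereal_ennreal)
  qed auto
  define a b where "a = (\<integral>\<^sup>+x. ennreal (?g x) \<partial>body_measure P)"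
    and "b = (\<integral>\<^sup>+x. ennreal (- ?g x) \<partial>body_measure P)"
  have "a \<noteq> \<infinity>" "b \<noteq> \<infinity>"
    using intg unfolding real_integrable_def a_def b_def by auto
  then have "enn2ereal a - enn2ereal b = ereal (enn2real a - enn2real b)"
    by (cases a; cases b) (auto simp: enn2ereal_ennreal)
  moreover have "enn2real a - enn2real b = (\<integral>x. ?g x \<partial>body_measure P)"
    unfolding a_def b_def using real_lebesgue_integral_def[OF intg] by simp
  moreover have "sigma_num P q = enn2ereal a - enn2ereal b"
    unfolding sigma_num_def Let_def 1 2 a_def b_def ..
  ultimately show ?thesis using int by (simp add: distrib_right)
qed

lemma muNA_lambda_eq:
  assumes [measurable]: "f \<in> borel_measurable borel"
    and q: "AE x in body_measure P. q x = ereal (f x)"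
    and qb: "\<And>Q. Q \<in> facets P \<Longrightarrow> AE x in facet_measure Q. q x = ereal (f x)"
    and int: "integrable (body_measure P) (\<lambda>x. exp (f x))"
      "integrable (body_measure P) (\<lambda>x. f x * exp (f x))"
    and intb: "\<And>Q. Q \<in> facets P \<Longrightarrow> integrable (facet_measure Q) (\<lambda>x. exp (f x))"
  shows "muNA_lambda P lam q = ereal (energy lam f)"
proof -
  define Z where "Z = (\<integral>x. exp (f x) \<partial>body_measure P)"
  have Z: "Z > 0" unfolding Z_def by (rule partition_pos[OF int(1)])
  have Zq: "Zq P q = ennreal Z" unfolding Z_def by (rule Zq_eq[OF assms(1) q int(1)])
  define H where "H = (\<integral>x. f x * exp (f x) \<partial>body_measure P)"
  have sig: "bsigma P q = ereal (real CARD('n) + H / Z - ln Z)"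
    unfolding bsigma_def sigma_num_eq[OF assms(1) q int] Zq using Z
    by (simp add: enn2ereal_ennreal Z_def[symmetric] H_def[symmetric] field_simps)
  define B where "B = bdry_int (\<lambda>x. exp (f x))"
  have "bdry_nn_integral P (\<lambda>x. eexp (q x)) = (\<Sum>Q\<in>facets P. \<integral>\<^sup>+x. ennreal (exp (f x)) \<partial>facet_measure Q)"
  proof (rule bdry_nn_integral_eq)
    show "AE x in facet_measure Q. eexp (q x) = ennreal (exp (f x))" if "Q \<in> facets P" for Q
      using qb[OF that] by eventually_elim (simp add: eexp_def)
  qed auto
  also have "\<dots> = (\<Sum>Q\<in>facets P. ennreal (\<integral>x. exp (f x) \<partial>facet_measure Q))"
    using intb by (intro sum.cong nn_integral_eq_integral) auto
  also have "\<dots> = ennreal B" unfolding B_def by (intro sum_ennreal integral_nonneg_AE) auto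
  finally have B: "bdry_nn_integral P (\<lambda>x. eexp (q x)) = ennreal B" .
  have "B \<ge> 0" unfolding B_def by (intro sum_nonneg integral_nonneg_AE) auto
  then have mu: "muNA P q = ereal (- (2 * pi) * B / Z)"
    unfolding muNA_def Zq B using Z by (simp add: enn2ereal_ennreal)
  show ?thesis
    unfolding muNA_lambda_def sig mu energy_def Zq
    using Z by (simp add: Z_def[symmetric] H_def[symmetric] B_def[symmetric])
qed

lemma muNA_lambda_continuous:
  assumes f: "continuous_on UNIV f"
  shows "muNA_lambda P lam (\<lambda>x. ereal (f x)) = ereal (energy lam f)"
  by (rule muNA_lambda_eq)
    (auto intro!: borel_measurable_continuous_onI concentrated_integrable_continuous[OF _ compact_P]
      conc_body conc_facet continuous_intros f)

lemma sbar_eq: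
  "sbar P lam xi = (2 * pi * bdry_int (\<lambda>x. exp (x \<bullet> xi))
      - lam * (\<integral>x. (x \<bullet> xi) * exp (x \<bullet> xi) \<partial>body_measure P)) / (\<integral>x. exp (x \<bullet> xi) \<partial>body_measure P)"
  unfolding sbar_def by (subst bdry_integral_eq int_P_eq; simp)+

lemma Fut_eq:
  assumes [measurable]: "u \<in> borel_measurable borel"
  shows "Fut P lam xi u = (2 * pi * bdry_int (\<lambda>x. u x * exp (x \<bullet> xi))
      - lam * (\<integral>x. u x * (x \<bullet> xi) * exp (x \<bullet> xi) \<partial>body_measure P)
      - sbar P lam xi * (\<integral>x. u x * exp (x \<bullet> xi) \<partial>body_measure P)) / (\<integral>x. exp (x \<bullet> xi) \<partial>body_measure P)"
proof -
  have "int_P P (\<lambda>x. u x * (x \<bullet> xi) * exp (x \<bullet> xi)) = (\<integral>x. u x * (x \<bullet> xi) * exp (x \<bullet> xi) \<partial>body_measure P)"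
    "int_P P (\<lambda>x. u x * exp (x \<bullet> xi)) = (\<integral>x. u x * exp (x \<bullet> xi) \<partial>body_measure P)"
    "int_P P (\<lambda>x. exp (x \<bullet> xi)) = (\<integral>x. exp (x \<bullet> xi) \<partial>body_measure P)"
    "bdry_integral P (\<lambda>x. u x * exp (x \<bullet> xi)) = bdry_int (\<lambda>x. u x * exp (x \<bullet> xi))"
    by (intro int_P_eq bdry_integral_eq; measurable)+
  then show ?thesis unfolding Fut_def by (simp add: diff_divide_distrib)
qed

text \<open>Nonnegativity of the relative entropy of the normalized density of \<open>exp f\<close>
  with respect to that of \<open>exp g\<close>, obtained by integrating
  \<open>1 + s \<le> exp s\<close> against \<open>exp f\<close>.\<close>

lemma gibbs_inequality:
  fixes f g :: "real^'n \<Rightarrow> real"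
  assumes f: "integrable (body_measure P) (\<lambda>x. exp (f x))"
      "integrable (body_measure P) (\<lambda>x. f x * exp (f x))"
    and g: "integrable (body_measure P) (\<lambda>x. exp (g x))"
      "integrable (body_measure P) (\<lambda>x. g x * exp (f x))"
  shows "(\<integral>x. g x * exp (f x) \<partial>body_measure P) / (\<integral>x. exp (f x) \<partial>body_measure P)
      - ln (\<integral>x. exp (g x) \<partial>body_measure P)
    \<le> (\<integral>x. f x * exp (f x) \<partial>body_measure P) / (\<integral>x. exp (f x) \<partial>body_measure P)
      - ln (\<integral>x. exp (f x) \<partial>body_measure P)"
proof -
  define Z where "Z = (\<integral>x. exp (f x) \<partial>body_measure P)"
  define W where "W = (\<integral>x. exp (g x) \<partial>body_measure P)"
  define H where "H = (\<integral>x. f x * exp (f x) \<partial>body_measure P)"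
  define X where "X = (\<integral>x. g x * exp (f x) \<partial>body_measure P)"
  have Z: "Z > 0" and W: "W > 0" using partition_pos[OF f(1)] partition_pos[OF g(1)]
    by (auto simp: Z_def W_def)
  \<comment> \<open>The constant by which \<open>g\<close> is shifted so that
    \<open>exp (g + L)\<close> has the same mass as \<open>exp f\<close>; the left side then
    integrates to zero.\<close>
  define L where "L = ln (Z / W)"
  have L: "exp L = Z / W" unfolding L_def using Z W by (intro exp_ln) simp
  have pw: "exp (f x) - Z / W * exp (g x) \<le> f x * exp (f x) - g x * exp (f x) - L * exp (f x)" for x
  proof -
    have "1 + (g x + L - f x) \<le> exp (g x + L - f x)" by (rule exp_ge_add_one_self)
    then have "(1 + (g x + L - f x)) * exp (f x) \<le> exp (g x + L - f x) * exp (f x)"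
      by (rule mult_right_mono) simp
    also have "\<dots> = exp L * exp (g x)" by (simp flip: exp_add)
    finally show ?thesis unfolding L by (simp add: algebra_simps)
  qed
  have "(\<integral>x. exp (f x) - Z / W * exp (g x) \<partial>body_measure P)
      \<le> (\<integral>x. f x * exp (f x) - g x * exp (f x) - L * exp (f x) \<partial>body_measure P)"
    by (rule integral_mono) (use f g pw in auto)
  also have "(\<integral>x. exp (f x) - Z / W * exp (g x) \<partial>body_measure P) = Z - Z / W * W"
    using f g by (simp add: Z_def W_def)
  also have "(\<integral>x. f x * exp (f x) - g x * exp (f x) - L * exp (f x) \<partial>body_measure P) = H - X - L * Z"
    using f g by (simp add: Z_def X_def H_def)
  finally have "X + L * Z \<le> H" using W by simp
  then have "(X + L * Z) / Z \<le> H / Z" using Z by (intro divide_right_mono) auto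
  then have "X / Z + L \<le> H / Z" using Z by (simp add: add_divide_distrib)
  then show ?thesis using Z W
    unfolding Z_def[symmetric] X_def[symmetric] H_def[symmetric] W_def[symmetric]
    by (simp add: L_def ln_div)
qed

text \<open>The hypothesis \<open>fut\<close> is a positive multiple of \<open>Fut\<close> at
  \<open>exp (f - xi)\<close>. Dividing it by \<open>Z\<close> bounds
  \<open>- 2 * pi * B / Z + lam * X / Z\<close> by the same expression for \<open>xi\<close>, and
  Gibbs times \<open>lam \<le> 0\<close> replaces the entropy \<open>H / Z - ln Z\<close> by
  \<open>X / Z - ln Z0\<close>, so the mean \<open>X / Z\<close> disappears.\<close>

lemma energy_le:
  fixes f :: "real^'n \<Rightarrow> real"
  assumes lam: "lam \<le> 0"
    and f: "integrable (body_measure P) (\<lambda>x. exp (f x))"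
      "integrable (body_measure P) (\<lambda>x. f x * exp (f x))"
      "integrable (body_measure P) (\<lambda>x. (x \<bullet> xi) * exp (f x))"
    and fut: "0 \<le> 2 * pi * bdry_int (\<lambda>x. exp (f x))
      - lam * (\<integral>x. (x \<bullet> xi) * exp (f x) \<partial>body_measure P)
      - sbar P lam xi * (\<integral>x. exp (f x) \<partial>body_measure P)"
  shows "energy lam f \<le> energy lam (\<lambda>x. x \<bullet> xi)"
proof -
  define Z where "Z = (\<integral>x. exp (f x) \<partial>body_measure P)"
  define Z0 where "Z0 = (\<integral>x. exp (x \<bullet> xi) \<partial>body_measure P)"
  define H where "H = (\<integral>x. f x * exp (f x) \<partial>body_measure P)"
  define X where "X = (\<integral>x. (x \<bullet> xi) * exp (f x) \<partial>body_measure P)"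
  define X0 where "X0 = (\<integral>x. (x \<bullet> xi) * exp (x \<bullet> xi) \<partial>body_measure P)"
  define B where "B = bdry_int (\<lambda>x. exp (f x))"
  define B0 where "B0 = bdry_int (\<lambda>x. exp (x \<bullet> xi))"
  note defs = Z_def[symmetric] Z0_def[symmetric] H_def[symmetric] X_def[symmetric]
    X0_def[symmetric] B_def[symmetric] B0_def[symmetric]
  have i0: "integrable (body_measure P) (\<lambda>x. exp (x \<bullet> xi))"
    by (intro concentrated_integrable_continuous[OF conc_body compact_P] continuous_intros)
  have Z: "Z > 0" using partition_pos[OF f(1)] by (simp add: Z_def)
  have Z0: "Z0 > 0" using partition_pos[OF i0] by (simp add: Z0_def)
  have "X / Z - ln Z0 \<le> H / Z - ln Z"
    using gibbs_inequality[OF f(1,2) i0 f(3)] unfolding defs .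
  then have G: "lam * (H / Z - ln Z) \<le> lam * (X / Z - ln Z0)"
    using lam by (rule mult_left_mono_neg)
  have s: "sbar P lam xi = 2 * pi * B0 / Z0 - lam * X0 / Z0"
    unfolding sbar_eq defs by (simp add: diff_divide_distrib)
  have "sbar P lam xi * Z / Z \<le> (2 * pi * B - lam * X) / Z"
    using fut Z unfolding defs by (intro divide_right_mono) auto
  then have "2 * pi * B0 / Z0 - lam * X0 / Z0 \<le> 2 * pi * B / Z - lam * X / Z"
    using Z by (simp add: s diff_divide_distrib)
  then show ?thesis using G unfolding energy_def defs by (simp add: algebra_simps)
qed

end

lemma continuous_on_Max_image:
  fixes f :: "'i \<Rightarrow> 'a::topological_space \<Rightarrow> real"
  assumes "finite I" "I \<noteq> {}" "\<And>i. i \<in> I \<Longrightarrow> continuous_on A (f i)"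
  shows "continuous_on A (\<lambda>x. Max ((\<lambda>i. f i x) ` I))"
  using assms
proof (induction I rule: finite_ne_induct)
  case (insert i I)
  have "(\<lambda>x. Max ((\<lambda>i. f i x) ` insert i I)) = (\<lambda>x. max (f i x) (Max ((\<lambda>i. f i x) ` I)))"
    using insert.hyps by simp
  then show ?case using insert by (auto intro!: continuous_on_max)
qed simp

lemma lsc_on_ereal_continuous:
  fixes f :: "real^'n \<Rightarrow> real"
  assumes "continuous_on UNIV f"
  shows "lsc_on_ereal P (\<lambda>x. ereal (f x))"
  unfolding lsc_on_ereal_def
proof
  fix x assume "x \<in> P"
  have "(f \<longlongrightarrow> f x) (at x within P)"
    using assms by (meson UNIV_I continuous_on_def subset_UNIV tendsto_within_subset)
  then have "((\<lambda>y. ereal (f y)) \<longlongrightarrow> ereal (f x)) (at x within P)" by (rule tendsto_ereal)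
  then show "ereal (f x) \<le> Liminf (at x within P) (\<lambda>x. ereal (f x))"
    unfolding le_Liminf_iff using order_tendstoD(1) by blast
qed

section \<open>Semistability implies maximality\<close>

context lattice_polytope
begin

lemma semistable_imp_le:
  fixes xi :: "real^'n"
  assumes ss: "toric_muK_semistable P lam xi" and lam: "lam \<le> 0" and q: "E1 P q"
  shows "muNA_lambda P lam q \<le> ereal (energy lam (\<lambda>x. x \<bullet> xi))"
proof -
  let ?mu = "body_measure P"
  obtain a :: "nat \<Rightarrow> real^'n" and c :: "nat \<Rightarrow> real" where ac:
    "\<And>i. rational_pt (a i)" "\<And>i. c i \<in> \<rat>" "a 0 = 0" "c 0 = 0"
    and sup: "\<And>x. x \<in> P \<Longrightarrow> twist xi q x = (SUP i. ennreal (a i \<bullet> x + c i))"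
    using convex_lsc_eq_Sup_rational_affine[OF twist_epigraph_convex[OF q convex_convex_hull]
        twist_epigraph_closed[OF q compact_imp_closed[OF compact_P]] compact_imp_bounded[OF compact_P]]
    by blast
  \<comment> \<open>Using \<open>m + 1\<close> indices keeps the maximum nonempty and always
    includes the zero function at index \<open>0\<close>.\<close>
  define W where "W m x = Max ((\<lambda>i. a i \<bullet> x + c i) ` {..<Suc m})" for m x
  have Wge: "a i \<bullet> x + c i \<le> W m x" if "i \<le> m" for i m x
    unfolding W_def using that by (intro Max_ge) auto
  have W0: "0 \<le> W m x" for m x using Wge[of 0 m x] ac by simp
  have contW: "continuous_on UNIV (W m)" for m
    unfolding W_def[abs_def] by (intro continuous_on_Max_image continuous_intros) auto
  then have [measurable]: "W m \<in> borel_measurable borel" for m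
    by (rule borel_measurable_continuous_onI)
  \<comment> \<open>Multiplying by \<open>exp (x \<bullet> xi)\<close>, the weight in
    \<open>Fut\<close>, undoes the twist: on \<open>P\<close> these functions increase to
    \<open>exp q\<close>.\<close>
  define V where "V m x = W m x * exp (x \<bullet> xi)" for m x
  have [measurable]: "V m \<in> borel_measurable borel" for m unfolding V_def[abs_def] by measurable
  have V0: "0 \<le> V m x" for m x using W0 by (simp add: V_def)
  have incV: "incseq (\<lambda>m. V m x)" for x
  proof (rule incseq_SucI)
    fix m
    have "W m x \<le> W (Suc m) x" unfolding W_def by (intro Max_mono) auto
    then show "V m x \<le> V (Suc m) x" by (simp add: V_def)
  qed
  define En where "En x = (SUP m. ennreal (V m x))" for x
  have [measurable]: "En \<in> borel_measurable borel" unfolding En_def[abs_def] by measurable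
  have En: "En x = eexp (q x)" if "x \<in> P" for x
  proof -
    have "(SUP m. ennreal (W m x)) = (SUP i. ennreal (a i \<bullet> x + c i))"
    proof (rule antisym)
      show "(SUP m. ennreal (W m x)) \<le> (SUP i. ennreal (a i \<bullet> x + c i))"
      proof (rule SUP_least)
        fix m
        have "W m x \<in> (\<lambda>i. a i \<bullet> x + c i) ` {..<Suc m}" unfolding W_def by (intro Max_in) auto
        then obtain i where "W m x = a i \<bullet> x + c i" by blast
        then show "ennreal (W m x) \<le> (SUP i. ennreal (a i \<bullet> x + c i))" by (auto intro: SUP_upper)
      qed
      show "(SUP i. ennreal (a i \<bullet> x + c i)) \<le> (SUP m. ennreal (W m x))"
        using Wge by (intro SUP_mono) (auto intro!: ennreal_leI)
    qed
    then have "(SUP m. ennreal (W m x)) * ennreal (exp (x \<bullet> xi)) = twist xi q x * ennreal (exp (x \<bullet> xi))"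
      using sup[OF that] by simp
    also have "\<dots> = eexp (q x)"
      by (simp add: twist_def mult.assoc flip: ennreal_mult exp_add)
    finally show ?thesis
      unfolding En_def V_def using W0 by (simp add: ennreal_mult SUP_mult_right_ennreal)
  qed
  \<comment> \<open>On \<open>P\<close> this is \<open>q\<close> wherever \<open>q\<close> is
    finite. Where \<open>En\<close> is infinite it takes the default value \<open>0\<close>, which
    affects only null sets for measures giving \<open>En\<close> a finite integral.\<close>
  define f where "f x = ln (enn2real (En x))" for x
  have [measurable]: "f \<in> borel_measurable borel" unfolding f_def[abs_def] by measurable
  have qf: "q x = ereal (f x) \<and> En x = ennreal (exp (f x))" if "x \<in> P" "En x \<noteq> \<infinity>" for x
    using that q En[OF that(1)] by (cases "q x") (auto simp: f_def eexp_def E1_def)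
  have AEq: "AE x in M. q x = ereal (f x)" "AE x in M. En x = ennreal (exp (f x))"
    if M: "concentrated P M" and fin: "(\<integral>\<^sup>+x. En x \<partial>M) < \<infinity>" for M
  proof -
    note [measurable_cong] = concentratedD(2)[OF M]
    have "AE x in M. En x \<noteq> \<infinity>" using fin by (intro nn_integral_PInf_AE) auto
    with concentratedD(3)[OF M] have "AE x in M. q x = ereal (f x) \<and> En x = ennreal (exp (f x))"
      by eventually_elim (use qf in blast)
    then show "AE x in M. q x = ereal (f x)" "AE x in M. En x = ennreal (exp (f x))" by auto
  qed
  have lim: "integrable M (\<lambda>x. exp (f x))" "integrable M (\<lambda>x. k x * exp (f x))"
    "(\<lambda>m. \<integral>x. k x * V m x \<partial>M) \<longlonglongrightarrow> (\<integral>x. k x * exp (f x) \<partial>M)"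
    if M: "concentrated P M" "(\<integral>\<^sup>+x. En x \<partial>M) < \<infinity>" and k: "continuous_on UNIV k" for M k
  proof -
    have [measurable]: "k \<in> borel_measurable borel" using k by (rule borel_measurable_continuous_onI)
    have "compact (k ` P)" using k continuous_on_subset compact_continuous_image compact_P by blast
    from compact_imp_bounded[OF this] obtain C where C: "\<And>x. x \<in> P \<Longrightarrow> \<bar>k x\<bar> \<le> C"
      by (auto simp: bounded_iff)
    note * = mono_limit_integral[of P M V k "\<lambda>x. exp (f x)" C, OF M(1) _ _ incV V0 _ _ _ _ C]
    show "integrable M (\<lambda>x. exp (f x))" "integrable M (\<lambda>x. k x * exp (f x))"
      "(\<lambda>m. \<integral>x. k x * V m x \<partial>M) \<longlonglongrightarrow> (\<integral>x. k x * exp (f x) \<partial>M)"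
      by (rule *; use M(2) AEq(2)[OF M] in \<open>simp add: En_def\<close>)+
  qed
  have "AE x in ?mu. eexp (q x) = En x"
    using concentratedD(3)[OF conc_body] by eventually_elim (simp add: En)
  then have ZqE: "Zq P q = (\<integral>\<^sup>+x. En x \<partial>?mu)"
    unfolding Zq_def by (intro nn_int_P_eq) auto
  then have finE: "(\<integral>\<^sup>+x. En x \<partial>?mu) < \<infinity>" using q by (simp add: E1_def Zq_def)
  note AEmu = AEq[OF conc_body finE]
  note limmu = lim[OF conc_body finE]
  have intf: "integrable ?mu (\<lambda>x. exp (f x))" using limmu(1) continuous_on_const by blast
  define Z where "Z = (\<integral>x. exp (f x) \<partial>?mu)"
  have Z: "Z > 0" unfolding Z_def by (rule partition_pos[OF intf])
  have Zq: "Zq P q = ennreal Z" unfolding Z_def by (rule Zq_eq[OF _ AEmu(1) intf]) measurable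
  show ?thesis
  proof (cases "bsigma P q < \<infinity>")
    case False
    then show ?thesis by (simp add: muNA_lambda_def)
  next
    case True
    let ?g = "\<lambda>x. (real CARD('n) + f x) * exp (f x)"
    have pos_part: "nn_int_P P (\<lambda>x. e2ennreal ((ereal (real CARD('n)) + q x) * enn2ereal (eexp (q x))))
        = (\<integral>\<^sup>+x. ennreal (?g x) \<partial>?mu)"
    proof (rule nn_int_P_eq)
      show "AE x in ?mu. e2ennreal ((ereal (real CARD('n)) + q x) * enn2ereal (eexp (q x)))
          = ennreal (?g x)"
        using AEmu(1) by eventually_elim (simp add: eexp_def e2ennreal_ereal enn2ereal_ennreal)
    qed auto
    have "(\<integral>\<^sup>+x. ennreal (?g x) \<partial>?mu) \<noteq> \<infinity>"
    proof
      assume inf: "(\<integral>\<^sup>+x. ennreal (?g x) \<partial>?mu) = \<infinity>"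
      \<comment> \<open>In \<open>ereal\<close>, infinity minus infinity is infinity, so a divergent
        positive part decides the value.\<close>
      have "sigma_num P q = \<infinity>"
        unfolding sigma_num_def Let_def pos_part inf by simp
      then have "bsigma P q = \<infinity>"
        unfolding bsigma_def Zq using Z by (simp add: enn2ereal_ennreal)
      then show False using True by simp
    qed
    then have "(\<integral>\<^sup>+x. ennreal (max 0 (?g x)) \<partial>?mu) < \<infinity>" by (simp add: ennreal_max_0 less_top)
    then have "integrable ?mu (\<lambda>x. max 0 (?g x))"
      by (intro integrableI_nonneg) (auto simp: body_measure_def)
    moreover have "integrable ?mu (\<lambda>x. 1::real)"
      by (intro concentrated_integrable_continuous[OF conc_body compact_P] continuous_intros)
    ultimately have "integrable ?mu (\<lambda>x. max 0 (?g x) + 1)" by (rule Bochner_Integration.integrable_add)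
    then have intff: "integrable ?mu (\<lambda>x. f x * exp (f x))"
    proof (rule Bochner_Integration.integrable_bound)
      \<comment> \<open>The negative part of \<open>f * exp f\<close> is at most \<open>1\<close>,
        which is integrable on \<open>P\<close>; finiteness of \<open>bsigma\<close> controls the
        positive part.\<close>
      have "\<bar>f x * exp (f x)\<bar> \<le> max 0 (?g x) + 1" for x
      proof -
        have "- f x \<le> exp (- f x)" using exp_ge_add_one_self[of "- f x"] by linarith
        then have "- f x * exp (f x) \<le> exp (- f x) * exp (f x)" by (rule mult_right_mono) simp
        then have "- (f x * exp (f x)) \<le> 1" by (simp flip: exp_add)
        moreover have "f x * exp (f x) \<le> ?g x" by (simp add: distrib_right)
        ultimately show ?thesis by linarith
      qed
      then show "AE x in ?mu. norm (f x * exp (f x)) \<le> norm (max 0 (?g x) + 1)" by simp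
    qed (auto simp: body_measure_def)
    show ?thesis
    proof (cases "bdry_nn_integral P (\<lambda>x. eexp (q x)) = \<infinity>")
      case inf: True
      \<comment> \<open>\<open>bsigma\<close> must be shown to be real: infinity plus minus infinity
        is infinity in \<open>ereal\<close>, so an infinite second summand could absorb
        \<open>muNA P q\<close>.\<close>
      have "bsigma P q = ereal ((real CARD('n) * Z + (\<integral>x. f x * exp (f x) \<partial>?mu)) / Z - ln Z)"
        unfolding bsigma_def sigma_num_eq[OF \<open>f \<in> borel_measurable borel\<close> AEmu(1) intf intff] Zq
        using Z by (simp add: enn2ereal_ennreal Z_def[symmetric])
      moreover have "muNA P q = -\<infinity>"
        unfolding muNA_def inf Zq using Z by (simp add: enn2ereal_ennreal)
      ultimately show ?thesis by (simp add: muNA_lambda_def)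
    next
      case False
      have "bdry_nn_integral P (\<lambda>x. eexp (q x)) = (\<Sum>Q\<in>facets P. \<integral>\<^sup>+x. En x \<partial>facet_measure Q)"
      proof (rule bdry_nn_integral_eq)
        show "AE x in facet_measure Q. eexp (q x) = En x" if "Q \<in> facets P" for Q
          using concentratedD(3)[OF conc_facet[OF that]] by eventually_elim (simp add: En)
      qed auto
      then have finQ: "(\<integral>\<^sup>+x. En x \<partial>facet_measure Q) < \<infinity>" if "Q \<in> facets P" for Q
        using False that finite_facets_P by (simp add: less_top)
      note AEQ = AEq[OF conc_facet finQ]
      note limQ = lim[OF conc_facet finQ]
      have intQ: "integrable (facet_measure Q) (\<lambda>x. exp (f x))" if "Q \<in> facets P" for Q
        using limQ(1)[OF that that] continuous_on_const by blast
      have c1: "continuous_on UNIV (\<lambda>x::real^'n. 1::real)" by simp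
      have cx: "continuous_on UNIV (\<lambda>x::real^'n. x \<bullet> xi)" by (intro continuous_intros)
      \<comment> \<open>The numerator of \<open>Fut\<close> at \<open>W m\<close>, nonnegative by
        semistability. The explicit factors \<open>1\<close> fit the weight \<open>k\<close> in the
        limit statements.\<close>
      define T where "T m = 2 * pi * bdry_int (\<lambda>x. 1 * V m x)
        - lam * (\<integral>x. (x \<bullet> xi) * V m x \<partial>?mu) - sbar P lam xi * (\<integral>x. 1 * V m x \<partial>?mu)" for m
      have "T \<longlonglongrightarrow> 2 * pi * bdry_int (\<lambda>x. 1 * exp (f x))
        - lam * (\<integral>x. (x \<bullet> xi) * exp (f x) \<partial>?mu) - sbar P lam xi * (\<integral>x. 1 * exp (f x) \<partial>?mu)"
        unfolding T_def
        by (intro tendsto_intros limQ(3) limmu(3) c1 cx)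
      moreover have "0 \<le> T m" for m
      proof -
        have "0 \<le> Fut P lam xi (W m)"
          using ss[unfolded toric_muK_semistable_def, rule_format, of "Suc m" a c] ac
          by (simp add: W_def[abs_def])
        moreover have "Fut P lam xi (W m) = T m / (\<integral>x. exp (x \<bullet> xi) \<partial>?mu)"
          unfolding Fut_eq[OF \<open>W m \<in> borel_measurable borel\<close>] T_def V_def by (simp add: mult_ac)
        moreover have "0 < (\<integral>x. exp (x \<bullet> xi) \<partial>?mu)"
          by (intro partition_pos concentrated_integrable_continuous[OF conc_body compact_P] continuous_intros)
        ultimately show ?thesis by (simp add: zero_le_divide_iff)
      qed
      ultimately have "0 \<le> 2 * pi * bdry_int (\<lambda>x. 1 * exp (f x))
        - lam * (\<integral>x. (x \<bullet> xi) * exp (f x) \<partial>?mu) - sbar P lam xi * (\<integral>x. 1 * exp (f x) \<partial>?mu)"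
        by (intro LIMSEQ_le_const) auto
      then have "energy lam f \<le> energy lam (\<lambda>x. x \<bullet> xi)"
        by (intro energy_le[OF lam intf intff limmu(2)[OF cx]]) simp
      moreover have "muNA_lambda P lam q = ereal (energy lam f)"
        by (rule muNA_lambda_eq) (use AEmu(1) AEQ(1) intf intff intQ in auto)
      ultimately show ?thesis by simp
    qed
  qed
qed

section \<open>Maximality implies semistability\<close>

lemma E1_continuous:
  assumes f: "continuous_on UNIV f" and "convex_on P f"
  shows "E1 P (\<lambda>x. ereal (f x))"
proof -
  have "Zq P (\<lambda>x. ereal (f x)) = ennreal (\<integral>x. exp (f x) \<partial>body_measure P)"
    by (rule Zq_eq) (auto intro!: borel_measurable_continuous_onI concentrated_integrable_continuous[OF _ compact_P]
      conc_body continuous_intros f)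
  moreover have "convex_on_ereal P (\<lambda>x. ereal (f x))"
    using convex_onD[OF assms(2)] by (simp add: convex_on_ereal_def)
  ultimately show ?thesis
    using lsc_on_ereal_continuous[OF f] by (simp add: E1_def Zq_def)
qed

text \<open>Quotient rule. The entropy contributes \<open>U 0 / Z 0\<close> through the product
  \<open>t * U t\<close>, which cancels the derivative of \<open>ln (Z t)\<close>; the remaining
  terms assemble into \<open>sbar\<close> and \<open>Fut\<close>.\<close>

lemma energy_derivative:
  fixes u :: "real^'n \<Rightarrow> real"
  assumes u: "continuous_on UNIV u"
  shows "((\<lambda>t. energy lam (\<lambda>x. x \<bullet> xi + t * u x)) has_real_derivative - Fut P lam xi u) (at 0)"
proof -
  let ?mu = "body_measure P"
  have cx: "continuous_on UNIV (\<lambda>x::real^'n. x \<bullet> xi)" by (intro continuous_intros)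
  have c1: "continuous_on UNIV (\<lambda>x::real^'n. 1::real)" by simp
  note int = concentrated_integrable_continuous[OF conc_body compact_P]
  define Z where "Z t = (\<integral>x. exp (x \<bullet> xi + t * u x) \<partial>?mu)" for t
  define X where "X t = (\<integral>x. (x \<bullet> xi) * exp (x \<bullet> xi + t * u x) \<partial>?mu)" for t
  define U where "U t = (\<integral>x. u x * exp (x \<bullet> xi + t * u x) \<partial>?mu)" for t
  define B where "B t = bdry_int (\<lambda>x. exp (x \<bullet> xi + t * u x))" for t
  define Y where "Y = (\<integral>x. u x * (x \<bullet> xi) * exp (x \<bullet> xi) \<partial>?mu)"
  define B' where "B' = bdry_int (\<lambda>x. u x * exp (x \<bullet> xi))"
  have H: "(\<integral>x. (x \<bullet> xi + t * u x) * exp (x \<bullet> xi + t * u x) \<partial>?mu) = X t + t * U t" for t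
  proof -
    have "integrable ?mu (\<lambda>x. (x \<bullet> xi) * exp (x \<bullet> xi + t * u x))"
      "integrable ?mu (\<lambda>x. u x * exp (x \<bullet> xi + t * u x))"
      by (intro int continuous_intros u)+
    then show ?thesis by (simp add: X_def U_def distrib_right mult.assoc)
  qed
  have dZ: "(Z has_real_derivative U 0) (at 0)"
    using integral_exp_derivative[OF conc_body compact_P cx u c1] by (simp add: Z_def[abs_def] U_def)
  have dX: "(X has_real_derivative Y) (at 0)"
    using integral_exp_derivative[OF conc_body compact_P cx u cx]
    by (simp add: X_def[abs_def] Y_def mult.commute mult.left_commute)
  \<comment> \<open>Only the existence of this derivative matters, since at \<open>t = 0\<close> it
    enters the derivative of \<open>t * U t\<close> with factor zero.\<close>
  have dU: "(U has_real_derivative (\<integral>x. u x * u x * exp (x \<bullet> xi) \<partial>?mu)) (at 0)"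
    using integral_exp_derivative[OF conc_body compact_P cx u u] by (simp add: U_def[abs_def])
  have dB: "(B has_real_derivative B') (at 0)"
    unfolding B_def[abs_def] B'_def
    using integral_exp_derivative[OF conc_facet compact_P cx u c1] by (intro DERIV_sum) simp
  have Z0: "Z 0 > 0" unfolding Z_def by (intro partition_pos int continuous_intros u)
  have E: "energy lam (\<lambda>x. x \<bullet> xi + t * u x)
    = - (2 * pi) * B t / Z t + lam * (real CARD('n) + (X t + t * U t) / Z t - ln (Z t))" for t
    unfolding energy_def H by (simp add: B_def Z_def)
  have s: "sbar P lam xi = (2 * pi * B 0 - lam * X 0) / Z 0"
    unfolding sbar_eq by (simp add: B_def X_def Z_def)
  have [measurable]: "u \<in> borel_measurable borel" using u by (rule borel_measurable_continuous_onI)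
  have Fut: "Fut P lam xi u = (2 * pi * B' - lam * Y - sbar P lam xi * U 0) / Z 0"
    by (subst Fut_eq) (simp_all add: B'_def Y_def U_def Z_def)
  have "((\<lambda>t. - (2 * pi) * B t / Z t + lam * (real CARD('n) + (X t + t * U t) / Z t - ln (Z t)))
    has_real_derivative
      - ((B' * (2 * pi) * Z 0 - 2 * pi * B 0 * U 0) / (Z 0 * Z 0))
      + lam * (((Y + U 0) * Z 0 - X 0 * U 0) / (Z 0 * Z 0) - U 0 / Z 0)) (at 0)"
    using Z0 by (auto intro!: derivative_eq_intros dZ dX dU dB)
  moreover have "- ((B' * (2 * pi) * Z 0 - 2 * pi * B 0 * U 0) / (Z 0 * Z 0))
      + lam * (((Y + U 0) * Z 0 - X 0 * U 0) / (Z 0 * Z 0) - U 0 / Z 0) = - Fut P lam xi u"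
    unfolding Fut s using Z0 by (simp add: field_simps)
  ultimately show ?thesis unfolding E by simp
qed

lemma convex_on_Max_affine:
  fixes a :: "nat \<Rightarrow> real^'n"
  assumes "m \<ge> 1" "convex A"
  shows "convex_on A (\<lambda>x. Max ((\<lambda>i. a i \<bullet> x + c i) ` {..<m}))"
proof (rule convex_onI)
  fix t :: real and x y :: "real^'n"
  assume t: "0 < t" "t < 1"
  have ne: "{..<m} \<noteq> {}" using assms(1) by (auto simp: lessThan_empty_iff)
  let ?u = "\<lambda>x. Max ((\<lambda>i. a i \<bullet> x + c i) ` {..<m})"
  have "a i \<bullet> ((1 - t) *\<^sub>R x + t *\<^sub>R y) + c i \<le> (1 - t) * ?u x + t * ?u y" if "i < m" for i
  proof -
    have "a i \<bullet> ((1 - t) *\<^sub>R x + t *\<^sub>R y) + c i = (1 - t) * (a i \<bullet> x + c i) + t * (a i \<bullet> y + c i)"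
      by (simp add: algebra_simps inner_add_right)
    also have "\<dots> \<le> (1 - t) * ?u x + t * ?u y"
      using t that by (intro add_mono mult_left_mono Max_ge) auto
    finally show ?thesis .
  qed
  then show "?u ((1 - t) *\<^sub>R x + t *\<^sub>R y) \<le> (1 - t) * ?u x + t * ?u y"
    using ne by (intro Max.boundedI) auto
qed (rule assms(2))

text \<open>For convex \<open>u\<close> the perturbation \<open>xi + t * u\<close> is known to be
  convex only for \<open>t \<ge> 0\<close>, so maximality gives a one-sided condition: the right
  derivative at \<open>0\<close>, which is \<open>- Fut\<close>, cannot be positive.\<close>

lemma le_imp_semistable:
  fixes xi :: "real^'n"
  assumes le: "\<And>q. E1 P q \<Longrightarrow> muNA_lambda P lam q \<le> ereal (energy lam (\<lambda>x. x \<bullet> xi))"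
  shows "toric_muK_semistable P lam xi"
  unfolding toric_muK_semistable_def
proof (intro allI impI)
  fix m :: nat and a :: "nat \<Rightarrow> real^'n" and c :: "nat \<Rightarrow> real"
  assume m: "1 \<le> m \<and> (\<forall>i<m. rational_pt (a i) \<and> c i \<in> \<rat>)"
  define u where "u x = Max ((\<lambda>i. a i \<bullet> x + c i) ` {..<m})" for x
  have "{..<m} \<noteq> {}" using m by (auto simp: lessThan_empty_iff)
  then have cu: "continuous_on UNIV u"
    unfolding u_def[abs_def] by (intro continuous_on_Max_image continuous_intros) auto
  have vu: "convex_on P u" unfolding u_def[abs_def] using m by (intro convex_on_Max_affine) auto
  have max0: "energy lam (\<lambda>x. x \<bullet> xi + t * u x) \<le> energy lam (\<lambda>x. x \<bullet> xi)" if "t \<ge> 0" for t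
  proof -
    have ct: "continuous_on UNIV (\<lambda>x. x \<bullet> xi + t * u x)" by (intro continuous_intros cu)
    have "convex_on P (\<lambda>x. x \<bullet> xi)"
      by (rule convex_onI) (auto simp: inner_add_left)
    then have "convex_on P (\<lambda>x. x \<bullet> xi + t * u x)"
      using convex_on_cmul[OF that vu] by (intro convex_on_add)
    from le[OF E1_continuous[OF ct this]] show ?thesis by (simp add: muNA_lambda_continuous[OF ct])
  qed
  have "0 \<le> Fut P lam xi u"
  proof (rule ccontr)
    assume "\<not> 0 \<le> Fut P lam xi u"
    then have "0 < - Fut P lam xi u" by simp
    from DERIV_pos_inc_right[OF energy_derivative[OF cu] this]
    obtain d where d: "d > 0" "\<And>h. h > 0 \<Longrightarrow> h < d \<Longrightarrow>
      energy lam (\<lambda>x. x \<bullet> xi + 0 * u x) < energy lam (\<lambda>x. x \<bullet> xi + (0 + h) * u x)" by blast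
    from d(2)[of "d / 2"] max0[of "d / 2"] d(1) show False by simp
  qed
  then show "0 \<le> Fut P lam xi (\<lambda>x. Max ((\<lambda>i. a i \<bullet> x + c i) ` {..<m}))"
    by (simp add: u_def[abs_def])
qed

end

theorem mainTheorem15:
  fixes S :: "(real^'n) set" and lam :: real and xi :: "real^'n"
  assumes "finite S" and "\<forall>z\<in>S. lattice_pt z"
    and "interior (convex hull S) \<noteq> {}"
    and "lam \<le> 0"
  shows "toric_muK_semistable (convex hull S) lam xi \<longleftrightarrow>
    (\<forall>q. E1 (convex hull S) q \<longrightarrow>
       muNA_lambda (convex hull S) lam q \<le> muNA_lambda (convex hull S) lam (\<lambda>x. ereal (x \<bullet> xi)))"
proof -
  interpret lattice_polytope S using assms by unfold_locales
  have "muNA_lambda (convex hull S) lam (\<lambda>x. ereal (x \<bullet> xi)) = ereal (energy lam (\<lambda>x. x \<bullet> xi))"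
    by (intro muNA_lambda_continuous continuous_intros)
  then show ?thesis using semistable_imp_le[OF _ assms(4)] le_imp_semistable by auto
qed

end
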